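(* Let $S\subset\mathbb{R}^2$ be the Sierpinski gasket, $s=\frac{\log 3}{\log 2}$, let $\mu$ be the normalised Hausdorff measure on $S$, and let $S_{01}=f_0(f_1(S))$. Let $C^s(S)$ denote the centred Hausdorff $s$-dimensional measure of $S$. Then $$C^{s}(S)=\min\left\{ \left(\theta_{\mu}^{s}(x,d)\right)^{-1}:\ x\in S_{01},\ \frac{\sqrt{3}}{16}\leq d\leq\frac{\sqrt{3}}{8}\right\},$$ where $\theta_\mu^s(x,d)=\dfrac{\mu(B(x,d))}{(2d)^s}$ (in particular, the minimum on the right-hand side is attained).
   Context: Let $M=\{0,1,2\}$ and let $f_i:\mathbb{R}^2\to\mathbb{R}^2$, $f_i(x)=\frac12 x+v_i$, $i\in M$, with $v_0=(0,0)$, $v_1=(\frac12,0)$, $v_2=\frac14(1,\sqrt3)$. The Sierpinski gasket $S$ is the unique non-empty compact set with $S=f_0(S)\cup f_1(S)\cup f_2(S)$. For a word $i=i_1i_2\dots i_k\in M^k$, $f_i:=f_{i_1}\circ f_{i_2}\circ\dots\circ f_{i_k}$ and $S_i:=f_i(S)$. $B(x,d)$ is the closed Euclidean ball with centre $x$ and radius $d$. $\mu:=\mathcal{H}^s\lfloor_S/\mathcal{H}^s(S)$ is the normalised $s$-dimensional Hausdorff measure on $S$, $s=\frac{\log3}{\log2}$; it coincides with the self-similar (invariant) Borel probability measure satisfying $\mu=\frac13\sum_{i\in M}\mu\circ f_i^{-1}$, and $\mu(S_i)=3^{-k}$ for $i\in M^k$. Centred Hausdorff measure: for $A\subset\mathbb{R}^n$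 put $$C_0^s(A)=\lim_{\delta\to0}\inf\Big\{\sum_{i=1}^\infty(2d_i)^s:\ 2d_i\le\delta,\ i=1,2,\dots\Big\},$$ the infimum being over all countable coverings $\{B(x_i,d_i)\}$ of $A$ by closed balls with centres $x_i\in A$ (with $C_0^s(\varnothing)=0$), and $$C^s(A)=\sup\{C_0^s(F):F\subset A,\ F\text{ closed}\}.$$ *)

theory Defs
  imports "HOL-Analysis.Analysis"
begin

definition gasket_shift :: "nat \<Rightarrow> real^2" where
  "gasket_shift i =
     (if i = 0 then vector [0, 0]
      else if i = 1 then vector [1/2, 0]
      else (1/4) *\<^sub>R vector [1, sqrt 3])"

(* Only the indices 0, 1, 2 are meaningful. *)
definition gasket_map :: "nat \<Rightarrow> real^2 \<Rightarrow> real^2" where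
  "gasket_map i x = (1/2) *\<^sub>R x + gasket_shift i"

definition sierpinski_gasket :: "(real^2) set" where
  "sierpinski_gasket =
     (THE S. S \<noteq> {} \<and> compact S \<and>
        S = gasket_map 0 ` S \<union> gasket_map 1 ` S \<union> gasket_map 2 ` S)"

definition gasket_dim :: real where
  "gasket_dim = ln 3 / ln 2"

(* Hausdorff outer measure, normalised by diam^s. Since 0 powr s = 0, the empty set costs
   nothing, so finite covers are included; the definition is meant for s > 0.
   Boundedness is required because diameter is a junk value on unbounded sets. *)
definition hausdorff_premeasure :: "real \<Rightarrow> real \<Rightarrow> 'a::metric_space set \<Rightarrow> ennreal" where
  "hausdorff_premeasure s \<delta> A =
     (INF U \<in> {U :: nat \<Rightarrow> 'a set. A \<subseteq> (\<Union>i. U i) \<and> (\<forall>i. bounded (U i) \<and> diameter (U i) \<le> \<delta>)}.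
        \<Sum>i. ennreal (diameter (U i) powr s))"

definition hausdorff_measure :: "real \<Rightarrow> 'a::metric_space set \<Rightarrow> ennreal" where
  "hausdorff_measure s A = Lim (at_right 0) (\<lambda>\<delta>. hausdorff_premeasure s \<delta> A)"

(* Given as a set function on all subsets of the plane; on Borel sets it is the normalised
   restriction of the Hausdorff measure to the gasket. *)
definition gasket_mu :: "(real^2) set \<Rightarrow> ennreal" where
  "gasket_mu A =
     hausdorff_measure gasket_dim (A \<inter> sierpinski_gasket) /
     hausdorff_measure gasket_dim sierpinski_gasket"

(* Covers are sequences of balls of positive radius; a finite cover of a nonempty set can be
   padded by arbitrarily small balls (s > 0) without changing the infimum. The empty set,
   which has no admissible centres, is treated separately. *)
definition centred_premeasure :: "real \<Rightarrow> real \<Rightarrow> 'a::metric_space set \<Rightarrow> ennreal" where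
  "centred_premeasure s \<delta> A =
     (INF (x, d) \<in> {(x :: nat \<Rightarrow> 'a, d :: nat \<Rightarrow> real).
          (\<forall>i. x i \<in> A \<and> 0 < d i \<and> 2 * d i \<le> \<delta>) \<and> A \<subseteq> (\<Union>i. cball (x i) (d i))}.
        \<Sum>i. ennreal ((2 * d i) powr s))"

definition centred_measure0 :: "real \<Rightarrow> 'a::metric_space set \<Rightarrow> ennreal" where
  "centred_measure0 s A =
     (if A = {} then 0 else Lim (at_right 0) (\<lambda>\<delta>. centred_premeasure s \<delta> A))"

(* centred_measure0 is not monotone in the set, hence the supremum over closed subsets. *)
definition centred_measure :: "real \<Rightarrow> 'a::metric_space set \<Rightarrow> ennreal" where
  "centred_measure s A = (SUP F \<in> {F. F \<subseteq> A \<and> closed F}. centred_measure0 s F)"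

definition gasket_density :: "real^2 \<Rightarrow> real \<Rightarrow> ennreal" where
  "gasket_density x d = gasket_mu (cball x d) / ennreal ((2 * d) powr gasket_dim)"

definition is_minimum :: "'b::order \<Rightarrow> 'b set \<Rightarrow> bool" where
  "is_minimum m X \<longleftrightarrow> m \<in> X \<and> (\<forall>y\<in>X. m \<le> y)"

end

(* The normalised Hausdorff measure agrees on closed sets with the self-similar measure nu, so it
   may be computed cell by cell. A ball of radius below sqrt 3 / 2 * 2^-k centred in a level-k cell
   meets only that cell and the at most three cells touching it. Up to a symmetry of the triangle
   the cell and its neighbours then form part of the configuration of S_01 and its neighbours, so
   the density of a small ball is at most that of a ball as in the theorem. By upper
   semicontinuity the densities over this compact parameter set have a maximum theta.
   Comparing measures in any cover by small balls gives C^s(S) >= 1/theta. Conversely, a closed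
   subset F of S is exhausted greedily by small near-copies, centred in F, of the ball of density
   theta: each round removes a fixed proportion of nu(F) at a cost of at most (1 + eps)/theta per
   unit of measure removed, and what is left in the end has a cheap cover by cell-sized balls. *)
theory Submission
  imports Defs "HOL-Probability.Stream_Space" "HOL-Probability.Probability_Mass_Function"
begin

section \<open>The gasket and its coding\<close>

text \<open>\<open>gasket_mu\<close> is a quotient of outer measures, and the value of H(S) is never
  computed: subadditivity, scaling and 0 < H(S) < infinity suffice to identify it on closed sets
  with \<open>nu\<close>, a genuine Borel measure. Sums over cells are sums over addresses, hence
  exact although neighbouring cells share vertices. The interval from sqrt 3 / 16 to sqrt 3 / 8 is
  one octave of radii. In units of a cell, a radius in [sqrt 3 / 4, sqrt 3 / 2) reaches only
  touching cells, since sqrt 3 / 2 is the height of the unit triangle; halving the radius passes to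
  the next level; and S_01 has level 2, which divides radii by 4. Level 2 is the first on which some
  cell is touched at all three vertices. The upper bound on C^s is where centring hurts: a ball of
  maximal density cannot be placed freely, because centres must lie in the subset F that is being
  covered. In the greedy rounds each ball is credited only with the mass removed from its own cell,
  so balls of one round may overlap without spoiling the estimate.\<close>

text \<open>Level-\<open>k\<close> cells are indexed by their lower left corner, in units of \<open>1/2^k\<close>, in the triangular
  lattice; in place of words this makes neighbouring cells visible arithmetically.\<close>

definition lattice_vec :: "int \<times> int \<Rightarrow> real^2" where
  "lattice_vec c = vector [of_int (fst c) + of_int (snd c) / 2, sqrt 3 / 2 * of_int (snd c)]"

definition cell_map :: "nat \<Rightarrow> int \<times> int \<Rightarrow> real^2 \<Rightarrow> real^2" where
  "cell_map k c z = (1 / 2^k) *\<^sub>R (z + lattice_vec c)"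

text \<open>Descending one level appends a binary digit to each coordinate, never 1 to both. So
  these are the pairs of k-bit numbers with disjoint binary supports, the pattern of Pascal's
  triangle modulo 2.\<close>

fun cells :: "nat \<Rightarrow> (int \<times> int) set" where
  "cells 0 = {(0, 0)}"
| "cells (Suc k) = (\<Union>(m, n) \<in> cells k. {(2*m, 2*n), (2*m + 1, 2*n), (2*m, 2*n + 1)})"

definition hutchinson :: "(real^2) set \<Rightarrow> (real^2) set" where
  "hutchinson A = gasket_map 0 ` A \<union> gasket_map 1 ` A \<union> gasket_map 2 ` A"

text \<open>Every index above 1 falls into the last branch of \<open>gasket_shift\<close> and acts
  like 2, so arbitrary natural numbers may serve as digits.\<close>

lemma gasket_map_cases: "gasket_map i \<in> {gasket_map 0, gasket_map 1, gasket_map 2}"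
  by (auto simp: gasket_map_def gasket_shift_def fun_eq_iff)

lemma dist_gasket_map: "dist (gasket_map i x) (gasket_map i y) = dist x y / 2"
  by (simp add: gasket_map_def dist_norm flip: scaleR_diff_right)

lemma norm_gasket_shift: "norm (gasket_shift i) \<le> 1 / 2"
  by (auto simp: gasket_shift_def norm_vec_def L2_set_def sum_2 power2_eq_square real_sqrt_divide)

lemma gasket_map_in_cball: "x \<in> cball 0 1 \<Longrightarrow> gasket_map i x \<in> cball 0 1"
  using norm_triangle_ineq[of "(1/2) *\<^sub>R x" "gasket_shift i"] norm_gasket_shift[of i]
  by (auto simp: gasket_map_def)

text \<open>Each point of A has a predecessor in A under one of the maps, and applying that map at
  least halves the distance to the invariant set K; n predecessors give distance at most D / 2^n.
  Uniqueness of the gasket, the enclosing triangle and the invariance under reflections all come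
  from this one-sided principle.\<close>

lemma attractor_subset:
  assumes "bounded A" "A \<subseteq> hutchinson A" "closed K" "K \<noteq> {}" "hutchinson K \<subseteq> K"
  shows "A \<subseteq> K"
proof -
  obtain k0 where k0: "k0 \<in> K" using assms by blast
  obtain D where D: "\<And>x. x \<in> A \<Longrightarrow> dist k0 x \<le> D"
    using assms(1) by (metis bounded_any_center)
  have *: "infdist x K \<le> D / 2^n" if "x \<in> A" for x n
    using that
  proof (induction n arbitrary: x)
    case 0
    then show ?case using D[of x] infdist_le[OF k0, of x] by (simp add: dist_commute)
  next
    case (Suc n)
    then obtain i y where y: "y \<in> A" "x = gasket_map i y" using assms(2)
      by (auto simp: hutchinson_def)
    have "infdist x K * 2 \<le> dist y k" if "k \<in> K" for k
    proof -
      have "gasket_map i k \<in> K"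
        using assms(5) gasket_map_cases[of i] that by (auto simp: hutchinson_def)
      from infdist_le[OF this, of x] show ?thesis by (simp add: y dist_gasket_map)
    qed
    then have "infdist x K * 2 \<le> infdist y K"
      using assms(4) by (auto simp: infdist_def intro!: cINF_greatest)
    then have "infdist x K \<le> infdist y K / 2" by simp
    also have "\<dots> \<le> D / 2^n / 2" using Suc.IH[OF y(1)] by (intro divide_right_mono) auto
    finally show ?case by (simp add: mult.commute)
  qed
  show ?thesis
  proof
    fix x assume x: "x \<in> A"
    have "(\<lambda>n. D / 2^n) \<longlonglongrightarrow> 0" by (rule LIMSEQ_divide_realpow_zero) simp
    from LIMSEQ_le_const[OF this] *[OF x] have "infdist x K \<le> 0" by auto
    then have "infdist x K = 0" using infdist_nonneg[of x K] by linarith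
    then show "x \<in> K" using in_closed_iff_infdist_zero[OF assms(3,4)] by auto
  qed
qed

text \<open>The coding map of the iterated function system: prefixing a digit to the stream applies
  the corresponding map to the point. Pushing independent digits forward along it produces
  \<open>nu\<close>.\<close>

definition code_point :: "nat stream \<Rightarrow> real^2" where
  "code_point s = (\<Sum>n. (1/2)^n *\<^sub>R gasket_shift (s !! n))"

lemma summable_code_point: "summable (\<lambda>n. (1/2)^n *\<^sub>R gasket_shift (s !! n))"
proof (rule summable_comparison_test')
  show "summable (\<lambda>n. (1/2::real)^n)" by (rule summable_geometric) simp
  show "norm ((1/2)^n *\<^sub>R gasket_shift (s !! n)) \<le> (1/2)^n" for n
    using norm_gasket_shift[of "s !! n"] by (simp add: mult_left_le)
qed

lemma code_point_SCons: "code_point (a ## s) = gasket_map a (code_point s)"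
proof -
  have "code_point (a ## s) = gasket_shift a + (\<Sum>n. (1/2)^Suc n *\<^sub>R gasket_shift (s !! n))"
    unfolding code_point_def
    using suminf_split_head[OF summable_code_point[of "a ## s"]] by (simp add: algebra_simps)
  also have "(\<Sum>n. (1/2)^Suc n *\<^sub>R gasket_shift (s !! n)) =
      (\<Sum>n. (1/2) *\<^sub>R ((1/2)^n *\<^sub>R gasket_shift (s !! n)))" by simp
  also have "\<dots> = (1/2) *\<^sub>R code_point s"
    unfolding code_point_def by (rule suminf_scaleR_right[OF summable_code_point, symmetric])
  finally show ?thesis by (simp add: gasket_map_def)
qed

lemma norm_code_point: "norm (code_point s) \<le> 1"
proof -
  have "norm (code_point s) \<le> (\<Sum>n. (1/2)^n * (1/2))"
    unfolding code_point_def
  proof (rule norm_suminf_le)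
    show "norm ((1/2)^n *\<^sub>R gasket_shift (s !! n)) \<le> (1/2)^n * (1/2)" for n
      using norm_gasket_shift[of "s !! n"] by (simp add: mult_left_mono)
    show "summable (\<lambda>n. (1/2::real)^n * (1/2))" by (intro summable_mult2 summable_geometric) simp
  qed
  also have "\<dots> = 1" by (subst suminf_mult2[symmetric]) (auto simp: suminf_geometric)
  finally show ?thesis .
qed

lemma hutchinson_range_code_point: "hutchinson (range code_point) = range code_point"
proof -
  have "x \<in> hutchinson (range code_point)" if "x = code_point s" for x s
  proof -
    have "x = gasket_map (shd s) (code_point (stl s))"
      using code_point_SCons[of "shd s" "stl s"] that by simp
    then show ?thesis using gasket_map_cases[of "shd s"] by (auto simp: hutchinson_def)
  qed
  then show ?thesis by (auto simp: hutchinson_def simp flip: code_point_SCons)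
qed

lemma closure_gasket_map: "closure (gasket_map i ` A) = gasket_map i ` closure A"
proof -
  have "gasket_map i ` B = (+) (gasket_shift i) ` ((*\<^sub>R) (1/2) ` B)" for B
    by (auto simp: gasket_map_def image_image add.commute)
  then show ?thesis by (simp add: closure_translation closure_scaleR)
qed

lemma closure_hutchinson: "closure (hutchinson A) = hutchinson (closure A)"
  by (simp add: hutchinson_def closure_gasket_map)

lemma gasket_fixpoint_unique:
  assumes "S \<noteq> {}" "compact S" "S = hutchinson S" "T \<noteq> {}" "compact T" "T = hutchinson T"
  shows "S = T"
proof
  show "S \<subseteq> T"
    by (rule attractor_subset[OF compact_imp_bounded[OF assms(2)] equalityD1[OF assms(3)]
          compact_imp_closed[OF assms(5)] assms(4) equalityD2[OF assms(6)]])
  show "T \<subseteq> S"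
    by (rule attractor_subset[OF compact_imp_bounded[OF assms(5)] equalityD1[OF assms(6)]
          compact_imp_closed[OF assms(2)] assms(1) equalityD2[OF assms(3)]])
qed

lemma bounded_code_points: "bounded (range code_point)"
  using norm_code_point by (auto simp: bounded_iff)

text \<open>With the closure, compactness follows from boundedness alone, and the fixed-point
  equation survives because each \<open>gasket_map\<close> commutes with taking closures. Uniqueness
  then evaluates the definite description.\<close>

lemma gasket_eq_closure: "sierpinski_gasket = closure (range code_point)"
proof -
  let ?S = "closure (range code_point)"
  have c: "compact ?S" by (simp add: bounded_code_points)
  have h: "?S = hutchinson ?S"
    by (simp only: hutchinson_range_code_point flip: closure_hutchinson)
  show ?thesis unfolding sierpinski_gasket_def
  proof (rule the_equality)
    show "?S \<noteq> {} \<and> compact ?S \<and>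
        ?S = gasket_map 0 ` ?S \<union> gasket_map 1 ` ?S \<union> gasket_map 2 ` ?S"
      by (intro conjI c h[unfolded hutchinson_def]) simp
    fix S :: "(real^2) set"
    assume S: "S \<noteq> {} \<and> compact S \<and>
        S = gasket_map 0 ` S \<union> gasket_map 1 ` S \<union> gasket_map 2 ` S"
    show "S = ?S"
    proof (rule gasket_fixpoint_unique)
      show "S = hutchinson S" unfolding hutchinson_def by (rule S[THEN conjunct2, THEN conjunct2])
    qed (rule S[THEN conjunct1] S[THEN conjunct2, THEN conjunct1] c h | simp)+
  qed
qed

lemma code_point_in_gasket: "code_point s \<in> sierpinski_gasket"
  unfolding gasket_eq_closure by (rule subsetD[OF closure_subset rangeI])

lemma gasket_nonempty [simp]: "sierpinski_gasket \<noteq> {}"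
  using code_point_in_gasket by blast

lemma compact_gasket: "compact sierpinski_gasket"
  by (simp add: gasket_eq_closure bounded_code_points)

lemma hutchinson_gasket: "hutchinson sierpinski_gasket = sierpinski_gasket"
  by (simp only: gasket_eq_closure hutchinson_range_code_point flip: closure_hutchinson)

lemma closed_gasket [simp]: "closed sierpinski_gasket"
  by (simp add: gasket_eq_closure)

lemma gasket_subset:
  assumes "closed K" "K \<noteq> {}" "hutchinson K \<subseteq> K"
  shows "sierpinski_gasket \<subseteq> K"
  using attractor_subset[OF compact_imp_bounded[OF compact_gasket] _ assms]
  by (simp add: hutchinson_gasket)

lemma norm_gasket:
  assumes "x \<in> sierpinski_gasket"
  shows "norm x \<le> 1"
proof -
  have "hutchinson (cball 0 1) \<subseteq> cball 0 1"
    using gasket_map_in_cball unfolding hutchinson_def by blast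
  from gasket_subset[OF _ _ this] assms show ?thesis by auto
qed

lemma dist_gasket: "x \<in> sierpinski_gasket \<Longrightarrow> y \<in> sierpinski_gasket \<Longrightarrow> dist x y \<le> 2"
  using norm_gasket[of x] norm_gasket[of y] norm_triangle_ineq4[of x y] by (simp add: dist_norm)

section \<open>Cells and the self-similar measure\<close>

lemma finite_cells [simp]: "finite (cells k)"
  by (induction k) auto

declare cells.simps(2) [simp del]

text \<open>A child determines its parent by halving and its place in it by parity, so children of
  different cells are different and nothing is counted twice.\<close>

lemma sum_cells_Suc:
  fixes f :: "int \<times> int \<Rightarrow> 'a::comm_monoid_add"
  shows "(\<Sum>c\<in>cells (Suc k). f c) =
    (\<Sum>(m, n)\<in>cells k. f (2*m, 2*n) + f (2*m + 1, 2*n) + f (2*m, 2*n + 1))"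
proof -
  have "(\<Sum>c\<in>cells (Suc k). f c) =
      (\<Sum>p\<in>cells k. \<Sum>c\<in>(case p of (m, n) \<Rightarrow> {(2*m, 2*n), (2*m + 1, 2*n), (2*m, 2*n + 1)}). f c)"
    unfolding cells.simps(2)
  proof (rule sum.UNION_disjoint)
    have "2 * m = 2 * m' + 1 \<longleftrightarrow> False" "2 * m + 1 = 2 * m' \<longleftrightarrow> False" for m m' :: int
      by presburger+
    then show "\<forall>i\<in>cells k. \<forall>j\<in>cells k. i \<noteq> j \<longrightarrow>
        (case i of (m, n) \<Rightarrow> {(2*m, 2*n), (2*m + 1, 2*n), (2*m, 2*n + 1)}) \<inter>
        (case j of (m, n) \<Rightarrow> {(2*m, 2*n), (2*m + 1, 2*n), (2*m, 2*n + 1)}) = {}"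
      by (auto simp del: One_nat_def)
  qed auto
  also have "\<dots> = (\<Sum>(m, n)\<in>cells k. f (2*m, 2*n) + f (2*m + 1, 2*n) + f (2*m, 2*n + 1))"
    by (rule sum.cong) (auto simp: add.assoc)
  finally show ?thesis .
qed

lemma card_cells: "card (cells k) = 3^k"
proof (induction k)
  case (Suc k)
  then show ?case using sum_cells_Suc[of "\<lambda>_. 1::nat" k] by simp
qed simp

text \<open>The doubled shifts are the lattice vectors of (0,0), (1,0) and (0,1); therefore a
  subcell has the doubled position plus one of these.\<close>

lemma cell_map_gasket_map:
  "cell_map k (m, n) (gasket_map 0 z) = cell_map (Suc k) (2*m, 2*n) z"
  "cell_map k (m, n) (gasket_map 1 z) = cell_map (Suc k) (2*m + 1, 2*n) z"
  "cell_map k (m, n) (gasket_map 2 z) = cell_map (Suc k) (2*m, 2*n + 1) z"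
  by (simp_all add: cell_map_def gasket_map_def gasket_shift_def lattice_vec_def vec_eq_iff
      forall_2 field_simps)

lemma cell_map_0 [simp]: "cell_map 0 (0, 0) z = z"
  by (simp add: cell_map_def lattice_vec_def vec_eq_iff forall_2)

lemma cell_map_compose:
  "cell_map k (m, n) \<circ> gasket_map 0 = cell_map (Suc k) (2*m, 2*n)"
  "cell_map k (m, n) \<circ> gasket_map 1 = cell_map (Suc k) (2*m + 1, 2*n)"
  "cell_map k (m, n) \<circ> gasket_map 2 = cell_map (Suc k) (2*m, 2*n + 1)"
  by (simp_all add: fun_eq_iff cell_map_gasket_map del: One_nat_def)

lemma gasket_eq_cells: "sierpinski_gasket = (\<Union>c\<in>cells k. cell_map k c ` sierpinski_gasket)"
proof (induction k)
  case (Suc k)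
  let ?S = sierpinski_gasket
  have eq: "cell_map k (m, n) ` ?S = cell_map (Suc k) (2*m, 2*n) ` ?S \<union>
      cell_map (Suc k) (2*m + 1, 2*n) ` ?S \<union> cell_map (Suc k) (2*m, 2*n + 1) ` ?S" for m n
  proof -
    have "cell_map k (m, n) ` ?S = cell_map k (m, n) ` hutchinson ?S"
      by (simp add: hutchinson_gasket)
    then show ?thesis
      by (simp only: hutchinson_def image_Un image_comp cell_map_compose)
  qed
  have "(\<Union>c\<in>cells (Suc k). cell_map (Suc k) c ` ?S) = (\<Union>c\<in>cells k. cell_map k c ` ?S)"
    unfolding cells.simps(2) UN_UN_flatten by (intro SUP_cong refl) (clarsimp simp only: split_paired_all prod.case eq UN_insert UN_empty Un_empty_right Un_assoc)
  with Suc show ?case by simp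
qed (auto simp: image_def)

lemma cell_map_in_gasket:
  "c \<in> cells k \<Longrightarrow> z \<in> sierpinski_gasket \<Longrightarrow> cell_map k c z \<in> sierpinski_gasket"
  using gasket_eq_cells[of k] by blast

lemma dist_cell_map: "dist (cell_map k c x) (cell_map k c y) = dist x y / 2^k"
  by (simp add: cell_map_def dist_norm flip: scaleR_diff_right)

lemma continuous_cell_map: "continuous_on A (cell_map k c)"
  unfolding cell_map_def by (intro continuous_intros)

lemma measurable_cell_map [measurable]: "cell_map k c \<in> borel_measurable borel"
  by (intro borel_measurable_continuous_onI continuous_cell_map)

lemma measurable_gasket_map [measurable]: "gasket_map i \<in> borel_measurable borel"
  unfolding gasket_map_def by measurable

lemma vimage_borel:
  "f \<in> borel_measurable borel \<Longrightarrow> A \<in> sets borel \<Longrightarrow> f -` A \<in> sets borel"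
  using measurable_sets[of f borel borel A] by simp

text \<open>The self-similar probability measure, as the law of a point with independent uniform digits.\<close>

definition digit_pmf :: "nat pmf" where
  "digit_pmf = pmf_of_set {0, 1, 2}"

definition nu :: "(real^2) measure" where
  "nu = distr (stream_space (measure_pmf digit_pmf)) borel code_point"

lemma measurable_code_point [measurable]:
  "code_point \<in> borel_measurable (stream_space (measure_pmf digit_pmf))"
proof -
  have [measurable]: "gasket_shift \<in> measurable (measure_pmf digit_pmf) borel"
    by simp
  have "(\<lambda>s. \<Sum>n. (1/2)^n *\<^sub>R gasket_shift (s !! n))
      \<in> borel_measurable (stream_space (measure_pmf digit_pmf))"
    by measurable
  then show ?thesis by (simp add: code_point_def[abs_def])
qed

lemma sets_nu [simp, measurable_cong]: "sets nu = sets borel"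
  by (simp add: nu_def)

lemma space_nu [simp]: "space nu = UNIV"
  by (simp add: nu_def)

lemma prob_space_nu: "prob_space nu"
  unfolding nu_def
  by (intro prob_space.prob_space_distr prob_space.prob_space_stream_space
      measure_pmf.prob_space_axioms measurable_code_point)

interpretation nu: prob_space nu
  by (rule prob_space_nu)

text \<open>Conditioning on the first digit: prefixing t to the stream acts on the coded point as
  \<open>gasket_map t\<close>, and the remaining digits have the same law.\<close>

lemma nu_self_similar:
  assumes A: "A \<in> sets borel"
  shows "measure nu A = (measure nu (gasket_map 0 -` A) + measure nu (gasket_map 1 -` A)
    + measure nu (gasket_map 2 -` A)) / 3"
proof -
  let ?P = "stream_space (measure_pmf digit_pmf)"
  interpret P: prob_space ?P
    by (intro prob_space.prob_space_stream_space measure_pmf.prob_space_axioms)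
  have sp: "space ?P = UNIV" by (simp add: space_stream_space)
  have m: "code_point -` B \<in> sets ?P" if "B \<in> sets borel" for B
    using measurable_sets[OF measurable_code_point that] by (simp add: sp)
  have e: "emeasure nu B = emeasure ?P (code_point -` B)" if "B \<in> sets borel" for B
    unfolding nu_def using that by (subst emeasure_distr) (auto simp: sp)
  have "emeasure nu A = (\<integral>\<^sup>+t. emeasure ?P {x \<in> space ?P. t ## x \<in> code_point -` A} \<partial>measure_pmf digit_pmf)"
    unfolding e[OF A] by (rule prob_space.emeasure_stream_space[OF measure_pmf.prob_space_axioms m[OF A]])
  also have "\<dots> = (\<integral>\<^sup>+t. emeasure nu (gasket_map t -` A) \<partial>measure_pmf digit_pmf)"
  proof (rule nn_integral_cong)
    fix t
    have "{x \<in> space ?P. t ## x \<in> code_point -` A} = code_point -` (gasket_map t -` A)"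
      by (auto simp: sp code_point_SCons)
    then show "emeasure ?P {x \<in> space ?P. t ## x \<in> code_point -` A} = emeasure nu (gasket_map t -` A)"
      using A by (simp add: e vimage_borel)
  qed
  also have "\<dots> = (\<Sum>t\<in>{0,1,2}. emeasure nu (gasket_map t -` A)) / 3"
    unfolding digit_pmf_def by (subst nn_integral_pmf_of_set) auto
  also have "\<dots> = ennreal (\<Sum>t\<in>{0,1,2}. measure nu (gasket_map t -` A)) / 3"
    by (simp add: nu.emeasure_eq_measure sum_nonneg flip: ennreal_plus)
  also have "\<dots> = ennreal ((\<Sum>t\<in>{0,1,2}. measure nu (gasket_map t -` A)) / 3)"
    by (subst divide_ennreal[symmetric]) (auto intro!: sum_nonneg)
  finally show ?thesis
    by (simp add: nu.emeasure_eq_measure sum_nonneg add.assoc del: One_nat_def)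
qed

lemma nu_cells:
  assumes A: "A \<in> sets borel"
  shows "measure nu A = (\<Sum>c\<in>cells k. measure nu (cell_map k c -` A)) / 3^k"
proof (induction k)
  case 0
  have "cell_map 0 (0, 0) -` A = A" by auto
  then show ?case by simp
next
  case (Suc k)
  have eq: "measure nu (cell_map k (m, n) -` A) = (measure nu (cell_map (Suc k) (2*m, 2*n) -` A)
      + measure nu (cell_map (Suc k) (2*m + 1, 2*n) -` A)
      + measure nu (cell_map (Suc k) (2*m, 2*n + 1) -` A)) / 3" for m n
    using nu_self_similar[OF vimage_borel[OF measurable_cell_map A], of k "(m, n)"]
    by (simp only: vimage_comp cell_map_compose)
  have "(\<Sum>c\<in>cells k. measure nu (cell_map k c -` A)) =
      (\<Sum>(m, n)\<in>cells k. (measure nu (cell_map (Suc k) (2*m, 2*n) -` A)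
      + measure nu (cell_map (Suc k) (2*m + 1, 2*n) -` A)
      + measure nu (cell_map (Suc k) (2*m, 2*n + 1) -` A)) / 3)"
    by (rule sum.cong[OF refl]) (clarsimp simp only: split_paired_all prod.case eq)
  also have "\<dots> = (\<Sum>c\<in>cells (Suc k). measure nu (cell_map (Suc k) c -` A)) / 3"
    by (simp add: sum_cells_Suc sum_divide_distrib case_prod_unfold)
  finally show ?case using Suc.IH by (simp only: power_Suc divide_divide_eq_left)
qed

lemma nu_gasket: "measure nu sierpinski_gasket = 1"
proof -
  have "AE s in stream_space (measure_pmf digit_pmf). code_point s \<in> sierpinski_gasket"
    by (simp add: code_point_in_gasket)
  then have "AE x in nu. x \<in> sierpinski_gasket"
    unfolding nu_def by (subst AE_distr_iff) auto
  then show ?thesis by (subst nu.prob_eq_1) auto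
qed

lemma nu_Int_gasket:
  assumes "A \<in> sets borel" shows "measure nu (A \<inter> sierpinski_gasket) = measure nu A"
  using nu_gasket assms by (intro nu.finite_measure_eq_AE) (auto simp: nu.prob_eq_1)

lemma nu_disjoint_gasket:
  assumes "A \<in> sets borel" "A \<inter> sierpinski_gasket = {}" shows "measure nu A = 0"
  using nu_Int_gasket[OF assms(1)] assms(2) by simp

lemma nu_superset_gasket:
  assumes "A \<in> sets borel" "sierpinski_gasket \<subseteq> A" shows "measure nu A = 1"
  using nu_Int_gasket[OF assms(1)] assms(2) nu_gasket by (simp add: Int_absorb1)

section \<open>Counting the cells that meet a set\<close>

definition hits :: "nat \<Rightarrow> (real^2) set \<Rightarrow> (int \<times> int) set" where
  "hits k F = {c \<in> cells k. cell_map k c ` sierpinski_gasket \<inter> F \<noteq> {}}"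

lemma finite_hits [simp]: "finite (hits k F)"
  by (simp add: hits_def)

lemma nu_hits:
  assumes "F \<in> sets borel"
  shows "measure nu F = (\<Sum>c\<in>hits k F. measure nu (cell_map k c -` F)) / 3^k"
proof -
  have "(\<Sum>c\<in>hits k F. measure nu (cell_map k c -` F)) =
      (\<Sum>c\<in>cells k. measure nu (cell_map k c -` F))"
  proof (rule sum.mono_neutral_left)
    show "\<forall>c\<in>cells k - hits k F. measure nu (cell_map k c -` F) = 0"
    proof
      fix c assume "c \<in> cells k - hits k F"
      then have "cell_map k c -` F \<inter> sierpinski_gasket = {}" by (auto simp: hits_def)
      then show "measure nu (cell_map k c -` F) = 0"
        by (intro nu_disjoint_gasket vimage_borel assms) auto
    qed
  qed (auto simp: hits_def)
  then show ?thesis using nu_cells[OF assms, of k] by simp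
qed

lemma nu_le_hits:
  assumes "F \<in> sets borel" shows "measure nu F \<le> card (hits k F) / 3^k"
proof -
  have "(\<Sum>c\<in>hits k F. measure nu (cell_map k c -` F)) \<le> (\<Sum>c\<in>hits k F. 1)"
    by (intro sum_mono) simp
  then show ?thesis by (subst nu_hits[OF assms, of k]) (simp add: divide_right_mono)
qed

lemma closed_infdist_le: "closed {x. infdist x F \<le> e}"
  by (intro closed_Collect_le continuous_intros)

text \<open>A level-k cell has diameter at most 2 / 2^k, so a cell meeting F lies entirely in this
  neighbourhood and contributes its full mass.\<close>

lemma hits_le_nu_nhd:
  assumes "F \<noteq> {}"
  shows "card (hits k F) / 3^k \<le> measure nu {x. infdist x F \<le> 2 / 2^k}"
proof -
  let ?U = "{x. infdist x F \<le> 2 / 2^k}"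
  have U: "?U \<in> sets borel" by (rule closed_infdist_le[THEN borel_closed])
  have "card (hits k F) = (\<Sum>c\<in>hits k F. measure nu (cell_map k c -` ?U))"
  proof -
    have "measure nu (cell_map k c -` ?U) = 1" if "c \<in> hits k F" for c
    proof (rule nu_superset_gasket[OF vimage_borel[OF _ U]])
      obtain z where z: "z \<in> sierpinski_gasket" "cell_map k c z \<in> F"
        using \<open>c \<in> hits k F\<close> by (auto simp: hits_def)
      show "sierpinski_gasket \<subseteq> cell_map k c -` ?U"
      proof
        fix y assume y: "y \<in> sierpinski_gasket"
        have "infdist (cell_map k c y) F \<le> dist (cell_map k c y) (cell_map k c z)"
          by (rule infdist_le[OF z(2)])
        also have "\<dots> \<le> 2 / 2^k" unfolding dist_cell_map
          by (intro divide_right_mono dist_gasket y z) auto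
        finally show "y \<in> cell_map k c -` ?U" by simp
      qed
    qed auto
    then show ?thesis by simp
  qed
  also have "\<dots> \<le> (\<Sum>c\<in>cells k. measure nu (cell_map k c -` ?U))"
    by (intro sum_mono2) (auto simp: hits_def)
  finally show ?thesis
    by (subst nu_cells[OF U, of k]) (simp add: divide_right_mono)
qed

text \<open>The count is squeezed between \<open>nu\<close> of F and \<open>nu\<close> of closed
  neighbourhoods that shrink to F. This limit drives both the comparison with Hausdorff measure and
  the choice of fine levels in the covering argument.\<close>

lemma hits_tendsto_nu:
  assumes "closed F"
  shows "(\<lambda>k. card (hits k F) / 3^k) \<longlonglongrightarrow> measure nu F"
proof (cases "F = {}")
  \<comment> \<open>\<open>infdist\<close> to the empty set is 0, so here the neighbourhoods would
    be the whole plane and would not shrink to F.\<close>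
  case True
  then show ?thesis by (simp add: hits_def)
next
  case False
  let ?U = "\<lambda>k::nat. {x. infdist x F \<le> 2 / 2^k}"
  have "(\<Inter>k. ?U k) = F"
  proof -
    have "x \<in> F" if "\<And>k::nat. infdist x F \<le> 2 / 2^k" for x
    proof -
      have "(\<lambda>k. 2 / 2^k :: real) \<longlonglongrightarrow> 0" by (rule LIMSEQ_divide_realpow_zero) simp
      from LIMSEQ_le_const[OF this] that have "infdist x F \<le> 0" by auto
      then show "x \<in> F"
        using in_closed_iff_infdist_zero[OF assms False] infdist_nonneg[of x F] by auto
    qed
    then show ?thesis by (auto simp: infdist_nonneg)
  qed
  moreover have "(\<lambda>k. measure nu (?U k)) \<longlonglongrightarrow> measure nu (\<Inter>k. ?U k)"
  proof (rule nu.finite_Lim_measure_decseq)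
    show "decseq ?U"
      by (auto simp: decseq_def elim!: order_trans intro!: divide_left_mono power_increasing)
  qed (auto intro: borel_closed[OF closed_infdist_le])
  ultimately have "(\<lambda>k. measure nu (?U k)) \<longlonglongrightarrow> measure nu F" by simp
  from tendsto_sandwich[OF _ _ tendsto_const this] show ?thesis
    using nu_le_hits[of F] hits_le_nu_nhd[OF False] assms by (auto intro: borel_closed)
qed

section \<open>Neighbouring cells\<close>

text \<open>The origin and the six shortest vectors of the triangular lattice, that is, the unit
  ball of the hexagonal norm max(|p|, |q|, |p + q|).\<close>

definition near_offsets :: "(int \<times> int) set" where
  "near_offsets = {(0, 0), (1, 0), (-1, 0), (0, 1), (0, -1), (1, -1), (-1, 1)}"

lemma near_offsetsI: "\<bar>p\<bar> \<le> 1 \<Longrightarrow> \<bar>q\<bar> \<le> 1 \<Longrightarrow> \<bar>p + q\<bar> \<le> 1 \<Longrightarrow> (p, q) \<in> near_offsets"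
  unfolding near_offsets_def by simp presburger

lemma lattice_vec_add: "lattice_vec (c + d) = lattice_vec c + lattice_vec d"
  by (simp add: lattice_vec_def vec_eq_iff forall_2 field_simps)

lemma lattice_vec_diff: "lattice_vec (c - d) = lattice_vec c - lattice_vec d"
  by (simp add: lattice_vec_def vec_eq_iff forall_2 field_simps)

text \<open>Coordinates with respect to the basis \<open>(1, 0)\<close>, \<open>(1/2, sqrt 3 / 2)\<close> of the lattice.\<close>

definition tri_u :: "real^2 \<Rightarrow> real" where "tri_u x = x $ 1 - x $ 2 / sqrt 3"
definition tri_v :: "real^2 \<Rightarrow> real" where "tri_v x = 2 * (x $ 2) / sqrt 3"

lemma tri_linear:
  "tri_u (x + y) = tri_u x + tri_u y" "tri_u (x - y) = tri_u x - tri_u y"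
  "tri_v (x + y) = tri_v x + tri_v y" "tri_v (x - y) = tri_v x - tri_v y"
  "tri_u (r *\<^sub>R x) = r * tri_u x" "tri_v (r *\<^sub>R x) = r * tri_v x"
  by (simp_all add: tri_u_def tri_v_def algebra_simps add_divide_distrib diff_divide_distrib)

lemma tri_lattice_vec [simp]:
  "tri_u (lattice_vec (p, q)) = p" "tri_v (lattice_vec (p, q)) = q"
  by (simp_all add: tri_u_def tri_v_def lattice_vec_def)

lemma gasket_map_lattice:
  "gasket_map 0 x = (1/2) *\<^sub>R (x + lattice_vec (0, 0))"
  "gasket_map 1 x = (1/2) *\<^sub>R (x + lattice_vec (1, 0))"
  "gasket_map 2 x = (1/2) *\<^sub>R (x + lattice_vec (0, 1))"
  using cell_map_gasket_map[of 0 0 0 x] by (simp_all add: cell_map_def[of "Suc 0"] del: One_nat_def)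

text \<open>Cauchy-Schwarz: each of the three functionals is the inner product with a vector of
  length 2 / sqrt 3. After squaring, the gap in each inequality is a perfect square.\<close>

lemma abs_tri_le:
  "\<bar>tri_u x\<bar> * (sqrt 3 / 2) \<le> norm x"
  "\<bar>tri_v x\<bar> * (sqrt 3 / 2) \<le> norm x"
  "\<bar>tri_u x + tri_v x\<bar> * (sqrt 3 / 2) \<le> norm x"
proof -
  define a b where "a = x $ 1" and "b = x $ 2 / sqrt 3"
  have n: "(norm x)\<^sup>2 = a\<^sup>2 + 3 * b\<^sup>2"
    unfolding norm_vec_def L2_set_def a_def b_def
    by (subst real_sqrt_pow2) (simp_all add: sum_2 power_divide)
  have *: "\<bar>t\<bar> * (sqrt 3 / 2) \<le> norm x" if "t\<^sup>2 * (3/4) \<le> a\<^sup>2 + 3 * b\<^sup>2" for t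
    by (rule power2_le_imp_le) (use that in \<open>simp_all add: n power_mult_distrib power_divide\<close>)
  have "(a - b)\<^sup>2 * (3/4) \<le> a\<^sup>2 + 3 * b\<^sup>2" "(a + b)\<^sup>2 * (3/4) \<le> a\<^sup>2 + 3 * b\<^sup>2"
    using zero_le_power2[of "a/2 + 3/2*b"] zero_le_power2[of "a/2 - 3/2*b"]
    by (simp_all add: power2_eq_square algebra_simps)
  moreover have "(2 * b)\<^sup>2 * (3/4) \<le> a\<^sup>2 + 3 * b\<^sup>2" by (simp add: power2_eq_square)
  ultimately show "\<bar>tri_u x\<bar> * (sqrt 3 / 2) \<le> norm x" "\<bar>tri_v x\<bar> * (sqrt 3 / 2) \<le> norm x"
    "\<bar>tri_u x + tri_v x\<bar> * (sqrt 3 / 2) \<le> norm x"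
    using *[of "a - b"] *[of "2 * b"] *[of "a + b"]
    by (simp_all add: tri_u_def tri_v_def a_def b_def add.commute)
qed

lemma gasket_triangle:
  assumes "x \<in> sierpinski_gasket"
  shows "0 \<le> tri_u x" "0 \<le> tri_v x" "tri_u x + tri_v x \<le> 1"
proof -
  let ?T = "{x. 0 \<le> tri_u x \<and> 0 \<le> tri_v x \<and> tri_u x + tri_v x \<le> 1}"
  have "sierpinski_gasket \<subseteq> ?T"
  proof (rule gasket_subset)
    show "closed ?T" unfolding tri_u_def tri_v_def
      by (intro closed_Collect_conj closed_Collect_le continuous_intros) auto
    show "?T \<noteq> {}" by (auto simp: tri_u_def tri_v_def intro!: exI[of _ 0])
    show "hutchinson ?T \<subseteq> ?T"
      by (auto simp: hutchinson_def gasket_map_lattice tri_linear field_simps simp del: One_nat_def)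
  qed
  with assms show "0 \<le> tri_u x" "0 \<le> tri_v x" "tri_u x + tri_v x \<le> 1" by auto
qed

text \<open>For two points of the gasket the three coordinates u, v and u + v differ by at most 1
  each. A distance below sqrt 3 / 2 in units of a cell adds strictly less than 1, so |p|, |q| and |p
  + q| are below 2; being integers, they are at most 1.\<close>

lemma near_cells:
  assumes y: "y \<in> sierpinski_gasket" and z: "z \<in> sierpinski_gasket"
    and d: "dist (cell_map k c y) (cell_map k c' z) < sqrt 3 / 2 / 2^k"
  shows "c' - c \<in> near_offsets"
proof -
  obtain p q where pq: "c' - c = (p, q)" by (cases "c' - c")
  define w where "w = y - z - lattice_vec (p, q)"
  have "cell_map k c y - cell_map k c' z = (1/2^k) *\<^sub>R w"
    unfolding w_def pq[symmetric] lattice_vec_diff cell_map_def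
    by (simp add: algebra_simps)
  then have "dist (cell_map k c y) (cell_map k c' z) = norm w / 2^k"
    by (simp add: dist_norm)
  with d have w: "norm w < sqrt 3 / 2" by (simp only: divide_less_cancel) simp
  have less1: "t < 1" if "t * (sqrt 3 / 2) \<le> norm w" for t
  proof -
    have "t * (sqrt 3 / 2) < 1 * (sqrt 3 / 2)" using that w by linarith
    then show ?thesis by (rule mult_right_less_imp_less) simp
  qed
  note l = less1[OF abs_tri_le(1)] less1[OF abs_tri_le(2)] less1[OF abs_tri_le(3)]
  have e: "tri_u w = tri_u y - tri_u z - p" "tri_v w = tri_v y - tri_v z - q"
    by (simp_all add: w_def tri_linear)
  note g = gasket_triangle[OF y] gasket_triangle[OF z]
  have "\<bar>real_of_int p\<bar> < 2" "\<bar>real_of_int q\<bar> < 2" "\<bar>real_of_int p + real_of_int q\<bar> < 2"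
    using l g unfolding e by linarith+
  then have "\<bar>p\<bar> \<le> 1" "\<bar>q\<bar> \<le> 1" "\<bar>p + q\<bar> \<le> 1" by linarith+
  then show ?thesis unfolding pq by (rule near_offsetsI)
qed

lemma vimage_cell_map_cball:
  "cell_map k (c + d) -` cball (cell_map k c y) r = cball (y - lattice_vec d) (2^k * r)"
proof -
  have "dist (cell_map k c y) (cell_map k (c + d) z) = dist (y - lattice_vec d) z / 2^k" for z
    by (simp add: cell_map_def dist_norm lattice_vec_add algebra_simps flip: scaleR_diff_right)
  then show ?thesis by (auto simp: pos_divide_le_eq mult.commute)
qed

definition nbr_offsets :: "nat \<Rightarrow> int \<times> int \<Rightarrow> (int \<times> int) set" where
  "nbr_offsets k c = {d \<in> near_offsets. c + d \<in> cells k}"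

lemma finite_near_offsets [simp]: "finite near_offsets"
  by (simp add: near_offsets_def)

text \<open>N may contain offsets at which there is no cell. This freedom lets an incomplete
  neighbourhood be enlarged to a full standard configuration.\<close>

lemma nu_cball_le:
  assumes y: "y \<in> sierpinski_gasket" and r: "r < sqrt 3 / 2 / 2^k"
    and N: "finite N" "nbr_offsets k c \<subseteq> N"
  shows "measure nu (cball (cell_map k c y) r) \<le>
    (\<Sum>d\<in>N. measure nu (cball (y - lattice_vec d) (2^k * r))) / 3^k"
proof -
  let ?B = "cball (cell_map k c y) r"
  have "hits k ?B \<subseteq> (+) c ` N"
  proof
    fix c' assume "c' \<in> hits k ?B"
    then obtain z where z: "z \<in> sierpinski_gasket" "cell_map k c' z \<in> ?B" "c' \<in> cells k"
      by (auto simp: hits_def)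
    then have "c' - c \<in> near_offsets" using r by (intro near_cells[where k = k, OF y z(1)]) auto
    then have "c' - c \<in> N" using N z by (auto simp: nbr_offsets_def)
    then show "c' \<in> (+) c ` N" by (intro image_eqI[of _ _ "c' - c"]) simp_all
  qed
  then have "(\<Sum>c'\<in>hits k ?B. measure nu (cell_map k c' -` ?B)) \<le>
      (\<Sum>c'\<in>(+) c ` N. measure nu (cell_map k c' -` ?B))"
    using N by (intro sum_mono2) auto
  also have "\<dots> = (\<Sum>d\<in>N. measure nu (cball (y - lattice_vec d) (2^k * r)))"
    by (subst sum.reindex) (simp_all add: vimage_cell_map_cball)
  finally show ?thesis
    by (subst nu_hits[of _ k]) (auto simp: divide_right_mono)
qed

lemma nu_cball_ge:
  assumes N: "(+) c ` N \<subseteq> cells k"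
  shows "(\<Sum>d\<in>N. measure nu (cball (y - lattice_vec d) (2^k * r))) / 3^k
    \<le> measure nu (cball (cell_map k c y) r)"
proof -
  let ?B = "cball (cell_map k c y) r"
  have "(\<Sum>d\<in>N. measure nu (cball (y - lattice_vec d) (2^k * r))) =
      (\<Sum>c'\<in>(+) c ` N. measure nu (cell_map k c' -` ?B))"
    by (subst sum.reindex) (simp_all add: vimage_cell_map_cball)
  also have "\<dots> \<le> (\<Sum>c'\<in>cells k. measure nu (cell_map k c' -` ?B))"
    by (intro sum_mono2 N) auto
  finally show ?thesis
    by (subst nu_cells[of _ k]) (auto simp: divide_right_mono)
qed

lemma gasket_cellE:
  assumes "x \<in> sierpinski_gasket"
  obtains c y where "c \<in> cells k" "y \<in> sierpinski_gasket" "x = cell_map k c y"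
  using assms gasket_eq_cells[of k] by blast

lemma nu_cball_le_level:
  assumes x: "x \<in> sierpinski_gasket" and r: "r < sqrt 3 / 2 / 2^k"
  shows "measure nu (cball x r) \<le> 7 / 3^k"
proof -
  obtain c y where c: "c \<in> cells k" "y \<in> sierpinski_gasket" "x = cell_map k c y"
    using gasket_cellE[OF x] .
  have "measure nu (cball x r) \<le>
      (\<Sum>d\<in>near_offsets. measure nu (cball (y - lattice_vec d) (2^k * r))) / 3^k"
    unfolding c(3) by (rule nu_cball_le[OF c(2) r]) (auto simp: nbr_offsets_def)
  also have "(\<Sum>d\<in>near_offsets. measure nu (cball (y - lattice_vec d) (2^k * r))) \<le>
      (\<Sum>d\<in>near_offsets. 1)"
    by (intro sum_mono) simp
  also have "\<dots> = 7" by (simp add: near_offsets_def)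
  finally show ?thesis by (simp add: divide_right_mono)
qed

section \<open>Scaling by powers of two and the mass of small balls\<close>

lemma gasket_dim_pos: "0 < gasket_dim"
  by (simp add: gasket_dim_def)

lemma two_powr_gasket_dim: "2 powr gasket_dim = 3"
  by (simp add: gasket_dim_def powr_def)

lemma power_two_powr_gasket_dim: "(2^k) powr gasket_dim = 3^k"
proof -
  have "(2^k) powr gasket_dim = 2 powr (gasket_dim * real k)"
    by (simp add: powr_powr mult.commute flip: powr_realpow)
  also have "\<dots> = (2 powr gasket_dim)^k"
    by (simp add: powr_powr[symmetric] powr_realpow two_powr_gasket_dim)
  finally show ?thesis by (simp add: two_powr_gasket_dim)
qed

lemma powr_gasket_dim_scale:
  "0 \<le> r \<Longrightarrow> (r / 2^k) powr gasket_dim = r powr gasket_dim / 3^k"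
  by (simp add: powr_divide power_two_powr_gasket_dim)

lemma dyadic_scale:
  fixes b r :: real
  assumes "0 < r" "r < b"
  obtains k where "b / 2 / 2^k \<le> r" "r < b / 2^k"
proof -
  have "(\<lambda>k. b / 2^k) \<longlonglongrightarrow> 0" by (rule LIMSEQ_divide_realpow_zero) simp
  from order_tendstoD(2)[OF this assms(1)] obtain j where j: "b / 2^j < r"
    by (auto simp: eventually_sequentially)
  define m where "m = (LEAST j. b / 2^j \<le> r)"
  have m: "b / 2^m \<le> r" unfolding m_def by (rule LeastI[of _ j]) (use j in simp)
  have "m \<noteq> 0" using m assms by (intro notI) simp
  then obtain k where k: "m = Suc k" by (cases m) auto
  then have "\<not> b / 2^k \<le> r" using not_less_Least[of k "\<lambda>j. b / 2^j \<le> r"] by (simp add: m_def)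
  with m k show ?thesis by (intro that[of k]) auto
qed

text \<open>A ball of radius r has mass of order at most r^s. At the level k with sqrt 3 / 4 <= 2^k
  * r < sqrt 3 / 2 it meets at most seven cells, whence the 7, and the left end of this octave gives
  the denominator. For r = 0 the bounds at all levels show that points have mass 0.\<close>

lemma nu_cball_le_powr:
  assumes x: "x \<in> sierpinski_gasket" and r: "0 \<le> r" "r < sqrt 3 / 2"
  shows "measure nu (cball x r) \<le> 7 / (sqrt 3 / 4) powr gasket_dim * r powr gasket_dim"
proof (cases "r = 0")
  case True
  have "(\<lambda>k. 7 / 3^k :: real) \<longlonglongrightarrow> 0" by (rule LIMSEQ_divide_realpow_zero) simp
  then have "measure nu (cball x 0) \<le> 0"
    by (rule LIMSEQ_le_const) (intro exI[of _ 0] allI impI nu_cball_le_level[OF x], simp)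
  then show ?thesis using True by simp
next
  case False
  then obtain k where k: "sqrt 3 / 2 / 2 / 2^k \<le> r" "r < sqrt 3 / 2 / 2^k"
    using r dyadic_scale[of r "sqrt 3 / 2"] by auto
  have "(sqrt 3 / 4) powr gasket_dim / 3^k = (sqrt 3 / 4 / 2^k) powr gasket_dim"
    by (rule powr_gasket_dim_scale[symmetric]) simp
  also have "\<dots> \<le> r powr gasket_dim" using k gasket_dim_pos by (intro powr_mono2) auto
  finally have "7 / 3^k \<le> 7 / (sqrt 3 / 4) powr gasket_dim * r powr gasket_dim"
    by (simp add: field_simps)
  with nu_cball_le_level[OF x k(2)] show ?thesis by linarith
qed

section \<open>Hausdorff measure\<close>

text \<open>Turns the limits in the definitions of the Hausdorff and of the centred measure into
  suprema, so that a bound at a single scale is already a lower bound for the measure.\<close>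

lemma Lim_at_right_0_eq_SUP:
  fixes g :: "real \<Rightarrow> ennreal"
  assumes "\<And>\<delta> \<epsilon>. 0 < \<delta> \<Longrightarrow> \<delta> \<le> \<epsilon> \<Longrightarrow> g \<epsilon> \<le> g \<delta>"
  shows "Lim (at_right 0) g = (SUP \<delta>\<in>{0<..}. g \<delta>)"
proof (rule tendsto_Lim)
  show "(g \<longlongrightarrow> (SUP \<delta>\<in>{0<..}. g \<delta>)) (at_right 0)"
  proof (rule order_tendstoI)
    fix a assume "a < (SUP \<delta>\<in>{0<..}. g \<delta>)"
    then obtain \<delta> where \<delta>: "0 < \<delta>" "a < g \<delta>" by (auto simp: less_SUP_iff)
    have "\<forall>\<^sub>F x in at_right 0. x \<in> {0<..<\<delta>}" using \<delta> by (intro eventually_at_right_real)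
    then show "\<forall>\<^sub>F x in at_right 0. a < g x"
      by eventually_elim (use assms \<delta> in \<open>auto intro: less_le_trans\<close>)
  next
    fix a assume a: "(SUP \<delta>\<in>{0<..}. g \<delta>) < a"
    have "\<forall>\<^sub>F x in at_right (0::real). x \<in> {0<..<1}" by (intro eventually_at_right_real) simp
    then show "\<forall>\<^sub>F x in at_right 0. g x < a"
      by eventually_elim (use a in \<open>auto intro: le_less_trans[OF SUP_upper]\<close>)
  qed
qed simp

lemma hausdorff_measure_eq_SUP:
  "hausdorff_measure s A = (SUP \<delta>\<in>{0<..}. hausdorff_premeasure s \<delta> A)"
  unfolding hausdorff_measure_def
  by (rule Lim_at_right_0_eq_SUP) (fastforce simp: hausdorff_premeasure_def intro!: INF_superset_mono intro: order_trans)

lemma hausdorff_premeasure_le_measure: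
  "0 < \<delta> \<Longrightarrow> hausdorff_premeasure s \<delta> A \<le> hausdorff_measure s A"
  unfolding hausdorff_measure_eq_SUP by (rule SUP_upper) simp

lemma hausdorff_premeasure_le:
  assumes "A \<subseteq> (\<Union>i. U i)" "\<And>i. bounded (U i)" "\<And>i. diameter (U i) \<le> \<delta>"
  shows "hausdorff_premeasure s \<delta> A \<le> (\<Sum>i. ennreal (diameter (U i) powr s))"
  unfolding hausdorff_premeasure_def using assms by (intro INF_lower) auto

lemma hausdorff_measure_mono: "A \<subseteq> B \<Longrightarrow> hausdorff_measure s A \<le> hausdorff_measure s B"
  unfolding hausdorff_measure_eq_SUP hausdorff_premeasure_def
  by (intro SUP_mono' INF_superset_mono) auto

lemma hausdorff_measure_empty: "hausdorff_measure s {} = 0"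
proof -
  have "hausdorff_premeasure s \<delta> ({} :: 'a set) = 0" if "0 < \<delta>" for \<delta>
    using hausdorff_premeasure_le[of "{} :: 'a set" "\<lambda>_. {}" \<delta> s] that by (simp add: diameter_def)
  then show ?thesis by (simp add: hausdorff_measure_eq_SUP)
qed

lemma hausdorff_premeasure_UN_le:
  fixes A :: "nat \<Rightarrow> 'a::metric_space set"
  shows "hausdorff_premeasure s \<delta> (\<Union>n. A n) \<le> (\<Sum>n. hausdorff_premeasure s \<delta> (A n))"
proof (cases "\<forall>n. hausdorff_premeasure s \<delta> (A n) < \<infinity>")
  case False
  then obtain n where n: "hausdorff_premeasure s \<delta> (A n) = \<infinity>" by (auto simp: less_top[symmetric])
  have "hausdorff_premeasure s \<delta> (A n) \<le> (\<Sum>n. hausdorff_premeasure s \<delta> (A n))"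
    using sum_le_suminf[of "\<lambda>n. hausdorff_premeasure s \<delta> (A n)" "{n}"] by simp
  then show ?thesis using n by (simp add: top_unique)
next
  case True
  show ?thesis
  proof (rule ennreal_le_epsilon)
    fix e :: real assume e: "0 < e"
    have "\<exists>U. A n \<subseteq> (\<Union>i. U i) \<and> (\<forall>i. bounded (U i) \<and> diameter (U i) \<le> \<delta>) \<and>
        (\<Sum>i. ennreal (diameter (U i) powr s)) \<le>
        hausdorff_premeasure s \<delta> (A n) + ennreal (e * (1/2)^Suc n)" for n
    proof -
      have "hausdorff_premeasure s \<delta> (A n) <
          hausdorff_premeasure s \<delta> (A n) + ennreal (e * (1/2)^Suc n)"
        using True e ennreal_add_left_cancel_less[of "hausdorff_premeasure s \<delta> (A n)" 0]
        by (simp add: less_top)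
      then obtain U :: "nat \<Rightarrow> 'a set" where
        "U \<in> {U. A n \<subseteq> (\<Union>i. U i) \<and> (\<forall>i. bounded (U i) \<and> diameter (U i) \<le> \<delta>)}"
        "(\<Sum>i. ennreal (diameter (U i) powr s)) <
          hausdorff_premeasure s \<delta> (A n) + ennreal (e * (1/2)^Suc n)"
        by (subst (asm) (1) hausdorff_premeasure_def) (auto simp: INF_less_iff)
      then show ?thesis by (intro exI[of _ U]) auto
    qed
    then obtain U where U: "\<And>n. A n \<subseteq> (\<Union>i. U n i)" "\<And>n i. bounded (U n i)"
      "\<And>n i. diameter (U n i) \<le> \<delta>"
      "\<And>n. (\<Sum>i. ennreal (diameter (U n i) powr s)) \<le>
        hausdorff_premeasure s \<delta> (A n) + ennreal (e * (1/2)^Suc n)"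
      by metis
    define V where "V p = (case prod_decode p of (n, i) \<Rightarrow> U n i)" for p
    have "(\<Union>n. A n) \<subseteq> (\<Union>p. V p)"
    proof
      fix x assume "x \<in> (\<Union>n. A n)"
      then obtain n i where "x \<in> U n i" using U(1) by blast
      then have "x \<in> V (prod_encode (n, i))" by (simp add: V_def)
      then show "x \<in> (\<Union>p. V p)" by blast
    qed
    then have "hausdorff_premeasure s \<delta> (\<Union>n. A n) \<le> (\<Sum>p. ennreal (diameter (V p) powr s))"
      by (rule hausdorff_premeasure_le) (auto simp: V_def U split: prod.splits)
    also have "(\<Sum>p. ennreal (diameter (V p) powr s)) =
        (\<Sum>n. \<Sum>i. ennreal (diameter (U n i) powr s))"
      using suminf_ennreal_2dimen[OF refl, of "\<lambda>(n, i). ennreal (diameter (U n i) powr s)"]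
      by (simp add: V_def case_prod_unfold)
    also have "\<dots> \<le> (\<Sum>n. hausdorff_premeasure s \<delta> (A n) + ennreal (e * (1/2)^Suc n))"
      by (intro suminf_le U) auto
    also have "\<dots> = (\<Sum>n. hausdorff_premeasure s \<delta> (A n)) + (\<Sum>n. ennreal (e * (1/2)^Suc n))"
      by (rule suminf_add[symmetric]) auto
    also have "(\<Sum>n. ennreal (e * (1/2)^Suc n)) = ennreal e"
      using e power_half_series[THEN sums_mult, of e]
      by (intro suminf_ennreal_eq) auto
    finally show "hausdorff_premeasure s \<delta> (\<Union>n. A n) \<le>
        (\<Sum>n. hausdorff_premeasure s \<delta> (A n)) + ennreal e" .
  qed
qed

lemma hausdorff_measure_UN_le:
  fixes A :: "nat \<Rightarrow> 'a::metric_space set"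
  shows "hausdorff_measure s (\<Union>n. A n) \<le> (\<Sum>n. hausdorff_measure s (A n))"
  unfolding hausdorff_measure_eq_SUP[of s "\<Union>n. A n"]
proof (rule SUP_least)
  fix \<delta> :: real assume "\<delta> \<in> {0<..}"
  have "hausdorff_premeasure s \<delta> (\<Union>n. A n) \<le> (\<Sum>n. hausdorff_premeasure s \<delta> (A n))"
    by (rule hausdorff_premeasure_UN_le)
  also have "\<dots> \<le> (\<Sum>n. hausdorff_measure s (A n))"
    using \<open>\<delta> \<in> {0<..}\<close> by (intro suminf_le hausdorff_premeasure_le_measure) auto
  finally show "hausdorff_premeasure s \<delta> (\<Union>n. A n) \<le> (\<Sum>n. hausdorff_measure s (A n))" .
qed

lemma hausdorff_measure_finite_UN_le:
  fixes A :: "'i \<Rightarrow> 'a::metric_space set"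
  assumes "finite I"
  shows "hausdorff_measure s (\<Union>i\<in>I. A i) \<le> (\<Sum>i\<in>I. hausdorff_measure s (A i))"
proof -
  obtain h where h: "bij_betw h {..<card I} I"
    using ex_bij_betw_nat_finite[OF assms] by (auto simp: atLeast0LessThan)
  define B where "B n = (if n < card I then A (h n) else {})" for n
  have "(\<Union>i\<in>h ` {..<card I}. A i) = (\<Union>n\<in>{..<card I}. A (h n))" by simp
  then have "(\<Union>i\<in>I. A i) = (\<Union>n\<in>{..<card I}. A (h n))"
    unfolding bij_betw_imp_surj_on[OF h] .
  then have "(\<Union>i\<in>I. A i) = (\<Union>n. B n)"
    by (auto simp: B_def split: if_splits)
  then have "hausdorff_measure s (\<Union>i\<in>I. A i) \<le> (\<Sum>n. hausdorff_measure s (B n))"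
    using hausdorff_measure_UN_le[of s B] by simp
  also have "\<dots> = (\<Sum>n<card I. hausdorff_measure s (B n))"
    by (rule suminf_finite) (auto simp: B_def hausdorff_measure_empty)
  also have "\<dots> = (\<Sum>n<card I. hausdorff_measure s (A (h n)))"
    by (intro sum.cong) (auto simp: B_def)
  also have "\<dots> = (\<Sum>i\<in>I. hausdorff_measure s (A i))"
    by (rule sum.reindex_bij_betw[OF h])
  finally show ?thesis .
qed

lemma hausdorff_premeasure_finite_cover_le:
  fixes U :: "'i \<Rightarrow> 'a::metric_space set"
  assumes I: "finite I" and cov: "A \<subseteq> (\<Union>i\<in>I. U i)" and \<delta>: "0 < \<delta>"
    and U: "\<And>i. i \<in> I \<Longrightarrow> bounded (U i)" "\<And>i. i \<in> I \<Longrightarrow> diameter (U i) \<le> \<delta>"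
  shows "hausdorff_premeasure s \<delta> A \<le> (\<Sum>i\<in>I. ennreal (diameter (U i) powr s))"
proof -
  obtain h where h: "bij_betw h {..<card I} I"
    using ex_bij_betw_nat_finite[OF I] by (auto simp: atLeast0LessThan)
  define B where "B n = (if n < card I then U (h n) else {})" for n
  have hI: "h n \<in> I" if "n < card I" for n using h that by (auto simp: bij_betw_def)
  have "(\<Union>i\<in>h ` {..<card I}. U i) = (\<Union>n\<in>{..<card I}. U (h n))" by simp
  then have "(\<Union>i\<in>I. U i) = (\<Union>n\<in>{..<card I}. U (h n))"
    unfolding bij_betw_imp_surj_on[OF h] .
  then have "(\<Union>i\<in>I. U i) = (\<Union>n. B n)"
    by (auto simp: B_def split: if_splits)
  then have "hausdorff_premeasure s \<delta> A \<le> (\<Sum>n. ennreal (diameter (B n) powr s))"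
    using cov \<delta> U hI by (intro hausdorff_premeasure_le) (auto simp: B_def diameter_def[of "{}"])
  also have "\<dots> = (\<Sum>n<card I. ennreal (diameter (B n) powr s))"
    by (rule suminf_finite) (auto simp: B_def diameter_def)
  also have "\<dots> = (\<Sum>n<card I. ennreal (diameter (U (h n)) powr s))"
    by (intro sum.cong) (auto simp: B_def)
  also have "\<dots> = (\<Sum>i\<in>I. ennreal (diameter (U i) powr s))"
    by (rule sum.reindex_bij_betw[OF h])
  finally show ?thesis .
qed

lemma diameter_image_le:
  assumes "\<And>x y. dist (f x) (f y) \<le> L * dist x y" "0 \<le> L" "bounded U"
  shows "bounded (f ` U)" "diameter (f ` U) \<le> L * diameter U"
proof -
  have d: "dist (f x) (f y) \<le> L * diameter U" if "x \<in> U" "y \<in> U" for x y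
    using assms(1)[of x y] mult_left_mono[OF diameter_bounded_bound[OF assms(3) that] assms(2)]
    by simp
  show "bounded (f ` U)"
  proof (cases "U = {}")
    case False
    then obtain x where "x \<in> U" by blast
    with d show ?thesis unfolding bounded_def by blast
  qed simp
  show "diameter (f ` U) \<le> L * diameter U"
  proof (cases "U = {}")
    case True then show ?thesis by (simp add: diameter_def)
  next
    case False
    with d show ?thesis by (auto simp: diameter_def[of "f ` U"] intro!: cSUP_least)
  qed
qed

lemma hausdorff_measure_image_le:
  fixes f :: "'a::metric_space \<Rightarrow> 'b::metric_space"
  assumes f: "\<And>x y. dist (f x) (f y) \<le> L * dist x y" and L: "0 < L" and s: "0 \<le> s"
  shows "hausdorff_measure s (f ` A) \<le> ennreal (L powr s) * hausdorff_measure s A"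
  unfolding hausdorff_measure_eq_SUP[of s "f ` A"]
proof (rule SUP_least)
  fix \<delta> :: real assume "\<delta> \<in> {0<..}"
  then have \<delta>: "0 < \<delta> / L" using L by simp
  have Ls: "0 < ennreal (L powr s)" using L by simp
  have "hausdorff_premeasure s \<delta> (f ` A) / ennreal (L powr s) \<le> hausdorff_premeasure s (\<delta> / L) A"
    unfolding hausdorff_premeasure_def[of s "\<delta> / L" A]
  proof (rule INF_greatest)
    fix U :: "nat \<Rightarrow> 'a set"
    assume "U \<in> {U. A \<subseteq> (\<Union>i. U i) \<and> (\<forall>i. bounded (U i) \<and> diameter (U i) \<le> \<delta> / L)}"
    then have U: "A \<subseteq> (\<Union>i. U i)" "\<And>i. bounded (U i)" "\<And>i. diameter (U i) \<le> \<delta> / L" by auto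
    have D: "diameter (f ` U i) \<le> L * diameter (U i)" for i
      using diameter_image_le(2)[OF f _ U(2)] L by simp
    have "hausdorff_premeasure s \<delta> (f ` A) \<le> (\<Sum>i. ennreal (diameter (f ` U i) powr s))"
    proof (rule hausdorff_premeasure_le)
      show "diameter (f ` U i) \<le> \<delta>" for i
        using D[of i] U(3)[of i] L by (simp add: pos_le_divide_eq mult.commute)
      show "f ` A \<subseteq> (\<Union>i. f ` U i)" using U(1) by blast
    qed (use U L diameter_image_le(1)[OF f _ U(2)] in auto)
    also have "\<dots> \<le> (\<Sum>i. ennreal (L powr s) * ennreal (diameter (U i) powr s))"
    proof (intro suminf_le)
      fix i
      have "diameter (f ` U i) powr s \<le> (L * diameter (U i)) powr s"
        using D[of i] s U(2) L
        by (intro powr_mono2 diameter_ge_0 diameter_image_le(1)[OF f]) auto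
      then show "ennreal (diameter (f ` U i) powr s) \<le>
          ennreal (L powr s) * ennreal (diameter (U i) powr s)"
        using L U(2) by (simp add: powr_mult diameter_ge_0 flip: ennreal_mult)
    qed auto
    also have "\<dots> = ennreal (L powr s) * (\<Sum>i. ennreal (diameter (U i) powr s))" by simp
    finally show "hausdorff_premeasure s \<delta> (f ` A) / ennreal (L powr s) \<le>
        (\<Sum>i. ennreal (diameter (U i) powr s))"
      using Ls by (intro divide_le_posI_ennreal) (auto simp: mult.commute)
  qed
  also have "\<dots> \<le> hausdorff_measure s A" by (rule hausdorff_premeasure_le_measure[OF \<delta>])
  finally have "hausdorff_premeasure s \<delta> (f ` A) / ennreal (L powr s) * ennreal (L powr s)
      \<le> hausdorff_measure s A * ennreal (L powr s)"
    by (rule mult_right_mono) simp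
  moreover have "hausdorff_premeasure s \<delta> (f ` A) / ennreal (L powr s) * ennreal (L powr s) =
      hausdorff_premeasure s \<delta> (f ` A)"
    using Ls by (subst ennreal_divide_times, subst ennreal_divide_self) auto
  ultimately show "hausdorff_premeasure s \<delta> (f ` A) \<le> ennreal (L powr s) * hausdorff_measure s A"
    by (simp only: mult.commute)
qed

section \<open>Hausdorff measure on the gasket\<close>

lemma diameter_gasket_cell:
  "bounded (cell_map k c ` sierpinski_gasket)"
  "diameter (cell_map k c ` sierpinski_gasket) \<le> 2 / 2^k"
proof -
  show "bounded (cell_map k c ` sierpinski_gasket)"
    by (intro compact_imp_bounded compact_continuous_image continuous_cell_map compact_gasket)
  show "diameter (cell_map k c ` sierpinski_gasket) \<le> 2 / 2^k"
    by (rule diameter_le)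
       (auto simp: dist_cell_map dist_gasket divide_right_mono simp flip: dist_norm)
qed

abbreviation "H \<equiv> hausdorff_measure gasket_dim"

text \<open>The 3^k cells cost (2 / 2^k)^s = 3 / 3^k each; the 3 is 2^s and reflects the crude bound
  2 for the diameter of the gasket. The aim is finiteness.\<close>

lemma H_gasket_le: "H sierpinski_gasket \<le> 3"
  unfolding hausdorff_measure_eq_SUP
proof (rule SUP_least)
  fix \<delta> :: real assume \<delta>: "\<delta> \<in> {0<..}"
  have "(\<lambda>k. 2 / 2^k :: real) \<longlonglongrightarrow> 0" by (rule LIMSEQ_divide_realpow_zero) simp
  from order_tendstoD(2)[OF this, of \<delta>] \<delta> obtain k where k: "2 / 2^k < \<delta>"
    by (auto simp: eventually_sequentially)
  have "hausdorff_premeasure gasket_dim \<delta> sierpinski_gasket \<le>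
      (\<Sum>c\<in>cells k. ennreal (diameter (cell_map k c ` sierpinski_gasket) powr gasket_dim))"
  proof (rule hausdorff_premeasure_finite_cover_le)
    show "diameter (cell_map k c ` sierpinski_gasket) \<le> \<delta>" for c
      using diameter_gasket_cell(2)[of k c] k by linarith
  qed (use \<delta> gasket_eq_cells[of k] diameter_gasket_cell(1) in auto)
  also have "\<dots> \<le> (\<Sum>c\<in>cells k. ennreal ((2 / 2^k) powr gasket_dim))"
    using gasket_dim_pos
    by (intro sum_mono ennreal_leI powr_mono2 diameter_gasket_cell diameter_ge_0) auto
  also have "\<dots> = 3"
    by (simp add: card_cells powr_gasket_dim_scale two_powr_gasket_dim
        ennreal_of_nat_eq_real_of_nat flip: ennreal_mult)
  finally show "hausdorff_premeasure gasket_dim \<delta> sierpinski_gasket \<le> 3" .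
qed

lemma H_gasket_finite: "H sierpinski_gasket < top"
  using H_gasket_le by (rule le_less_trans) simp

text \<open>The mass distribution principle with the bound of order r^s on the mass of balls. The
  scale 1/2 keeps all radii below sqrt 3 / 2, where that bound applies.\<close>

lemma H_gasket_pos: "0 < H sierpinski_gasket"
proof -
  define C where "C = 7 / (sqrt 3 / 4) powr gasket_dim"
  have C: "0 < C" by (simp add: C_def)
  have "ennreal (1 / C) \<le> hausdorff_premeasure gasket_dim (1/2) sierpinski_gasket"
    unfolding hausdorff_premeasure_def
  proof (rule INF_greatest)
    fix U :: "nat \<Rightarrow> (real^2) set"
    assume "U \<in> {U. sierpinski_gasket \<subseteq> (\<Union>i. U i) \<and> (\<forall>i. bounded (U i) \<and> diameter (U i) \<le> 1/2)}"
    then have U: "sierpinski_gasket \<subseteq> (\<Union>i. U i)" "\<And>i. bounded (U i)" "\<And>i. diameter (U i) \<le> 1/2"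
      by auto
    \<comment> \<open>A covering set may fail to be Borel and need not be centred in the gasket; it
      is replaced by a ball about one of its points in the gasket, with its diameter as
      radius.\<close>
    define x where "x i = (SOME x. x \<in> U i \<inter> sierpinski_gasket)" for i
    define V where "V i = (if U i \<inter> sierpinski_gasket = {} then {} else cball (x i) (diameter (U i)))" for i
    have x: "x i \<in> U i \<inter> sierpinski_gasket" if "U i \<inter> sierpinski_gasket \<noteq> {}" for i
      unfolding x_def by (rule someI_ex) (use that in blast)
    have V: "V i \<in> sets nu" for i by (simp add: V_def)
    have "sqrt 3 > 1" by simp
    have VC: "measure nu (V i) \<le> C * diameter (U i) powr gasket_dim" for i
    proof (cases "U i \<inter> sierpinski_gasket = {}")
      case False
      have "diameter (U i) < sqrt 3 / 2" using U(3)[of i] \<open>sqrt 3 > 1\<close> by linarith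
      from nu_cball_le_powr[OF _ diameter_ge_0[OF U(2)] this] x[OF False] False
      show ?thesis unfolding V_def C_def by simp
    qed (use C in \<open>simp add: V_def\<close>)
    have "sierpinski_gasket \<subseteq> (\<Union>i. V i)"
    proof
      fix y assume y: "y \<in> sierpinski_gasket"
      then obtain i where i: "y \<in> U i" using U(1) by blast
      with y have "U i \<inter> sierpinski_gasket \<noteq> {}" by blast
      with i x[of i] diameter_bounded_bound[OF U(2), of "x i" i y] have "y \<in> V i" by (simp add: V_def)
      then show "y \<in> (\<Union>i. V i)" by blast
    qed
    have "1 = emeasure nu sierpinski_gasket" by (simp add: nu.emeasure_eq_measure nu_gasket)
    also have "\<dots> \<le> emeasure nu (\<Union>i. V i)"
      using V \<open>sierpinski_gasket \<subseteq> (\<Union>i. V i)\<close> by (intro emeasure_mono) auto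
    also have "\<dots> \<le> (\<Sum>i. emeasure nu (V i))" using V by (intro emeasure_subadditive_countably) auto
    also have "\<dots> \<le> (\<Sum>i. ennreal C * ennreal (diameter (U i) powr gasket_dim))"
      using VC C by (intro suminf_le) (auto simp: nu.emeasure_eq_measure simp flip: ennreal_mult)
    also have "\<dots> = ennreal C * (\<Sum>i. ennreal (diameter (U i) powr gasket_dim))" by simp
    finally have "1 / ennreal C \<le> (\<Sum>i. ennreal (diameter (U i) powr gasket_dim))"
      using C by (intro divide_le_posI_ennreal) auto
    moreover have "ennreal (1 / C) = 1 / ennreal C"
      using divide_ennreal[of 1 C] C by simp
    ultimately show "ennreal (1 / C) \<le> (\<Sum>i. ennreal (diameter (U i) powr gasket_dim))" by simp
  qed
  also have "\<dots> \<le> H sierpinski_gasket" by (rule hausdorff_premeasure_le_measure) simp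
  finally have "ennreal (1 / C) \<le> H sierpinski_gasket" .
  moreover have "0 < ennreal (1 / C)" using C by simp
  ultimately show ?thesis by (rule less_le_trans[rotated])
qed

lemma H_cell_le: "H (cell_map k c ` sierpinski_gasket) \<le> ennreal (1 / 3^k) * H sierpinski_gasket"
proof -
  have "H (cell_map k c ` sierpinski_gasket) \<le> ennreal ((1 / 2^k) powr gasket_dim) * H sierpinski_gasket"
    using gasket_dim_pos by (intro hausdorff_measure_image_le) (auto simp: dist_cell_map)
  then show ?thesis by (simp add: powr_gasket_dim_scale)
qed

lemma H_cells_le:
  assumes "finite I"
  shows "H (\<Union>c\<in>I. cell_map k c ` sierpinski_gasket) \<le>
    ennreal (card I / 3^k) * H sierpinski_gasket"
proof -
  have "H (\<Union>c\<in>I. cell_map k c ` sierpinski_gasket) \<le> (\<Sum>c\<in>I. H (cell_map k c ` sierpinski_gasket))"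
    by (rule hausdorff_measure_finite_UN_le[OF assms])
  also have "\<dots> \<le> (\<Sum>c\<in>I. ennreal (1 / 3^k) * H sierpinski_gasket)"
    by (intro sum_mono H_cell_le)
  also have "\<dots> = ennreal (card I / 3^k) * H sierpinski_gasket"
    by (simp add: ennreal_of_nat_eq_real_of_nat mult.assoc[symmetric] flip: ennreal_mult)
  finally show ?thesis .
qed

text \<open>F is covered by the level-k cells that meet it, and their total normalised mass tends to
  \<open>nu\<close> of F.\<close>

lemma H_le_nu:
  assumes F: "closed F" "F \<subseteq> sierpinski_gasket"
  shows "H F \<le> ennreal (measure nu F) * H sierpinski_gasket"
proof (rule LIMSEQ_le_const)
  show "(\<lambda>k. ennreal (card (hits k F) / 3^k) * H sierpinski_gasket)
      \<longlonglongrightarrow> ennreal (measure nu F) * H sierpinski_gasket"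
    using H_gasket_finite
    by (intro ennreal_tendsto_cmult[where c = "H sierpinski_gasket", unfolded mult.commute[of "H sierpinski_gasket"]]
        tendsto_ennrealI hits_tendsto_nu F) (simp add: less_top)
  have "H F \<le> ennreal (card (hits k F) / 3^k) * H sierpinski_gasket" for k
  proof -
    have "F \<subseteq> (\<Union>c\<in>hits k F. cell_map k c ` sierpinski_gasket)"
    proof
      fix x assume x: "x \<in> F"
      then obtain c y where c: "c \<in> cells k" "y \<in> sierpinski_gasket" "x = cell_map k c y"
        using gasket_cellE[of x k] F(2) by blast
      with x have "c \<in> hits k F" unfolding hits_def by blast
      with c show "x \<in> (\<Union>c\<in>hits k F. cell_map k c ` sierpinski_gasket)" by blast
    qed
    then have "H F \<le> H (\<Union>c\<in>hits k F. cell_map k c ` sierpinski_gasket)"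
      by (rule hausdorff_measure_mono)
    also have "\<dots> \<le> ennreal (card (hits k F) / 3^k) * H sierpinski_gasket"
      by (rule H_cells_le) simp
    finally show ?thesis .
  qed
  then show "\<exists>N. \<forall>n\<ge>N. H F \<le> ennreal (card (hits n F) / 3^n) * H sierpinski_gasket" by blast
qed


lemma hits_Suc_parent:
  assumes "c \<in> hits (Suc k) F"
  obtains m n where "(m, n) \<in> hits k F" "c \<in> {(2*m, 2*n), (2*m + 1, 2*n), (2*m, 2*n + 1)}"
proof -
  from assms obtain z where z: "z \<in> sierpinski_gasket" "cell_map (Suc k) c z \<in> F" "c \<in> cells (Suc k)"
    by (auto simp: hits_def)
  then obtain m n where mn: "(m, n) \<in> cells k" "c \<in> {(2*m, 2*n), (2*m + 1, 2*n), (2*m, 2*n + 1)}"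
    by (auto simp: cells.simps(2))
  have "gasket_map i z \<in> sierpinski_gasket" if "i \<in> {0, 1, 2}" for i
    using hutchinson_gasket z(1) that by (auto simp: hutchinson_def)
  moreover obtain i where i: "i \<in> {0, 1, 2}" "cell_map k (m, n) (gasket_map i z) = cell_map (Suc k) c z"
    using mn(2) cell_map_gasket_map[of k m n z] by (metis insert_iff empty_iff)
  ultimately have "gasket_map i z \<in> sierpinski_gasket" "cell_map k (m, n) (gasket_map i z) \<in> F"
    using z(2) by auto
  then have "(m, n) \<in> hits k F" using mn(1) unfolding hits_def by blast
  with mn(2) show ?thesis by (rule that[rotated])
qed

text \<open>A point outside the closed set F eventually lies in no cell meeting F. Sorting the
  points by the level at which this happens covers the complement by the cells discarded at each
  level, whose masses telescope to the initial mass minus \<open>nu\<close> of F.\<close>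

lemma nu_complement_le_H:
  assumes F: "closed F" "F \<subseteq> sierpinski_gasket" "F \<noteq> {}"
  shows "H (sierpinski_gasket - F) \<le> ennreal (1 - measure nu F) * H sierpinski_gasket"
proof -
  let ?S = sierpinski_gasket
  define N where "N k = hits k F" for k
  define ch where "ch k = (\<Union>(m, n)\<in>N k. {(2*m, 2*n), (2*m + 1, 2*n), (2*m, 2*n + 1)})" for k
  define a where "a k = card (N k) / (3::real)^k" for k
  have fin: "finite (N k)" "finite (ch k)" for k by (auto simp: N_def ch_def)
  have sub: "N (Suc k) \<subseteq> ch k" for k
  proof
    fix c assume "c \<in> N (Suc k)"
    then obtain m n where "(m, n) \<in> N k" "c \<in> {(2*m, 2*n), (2*m + 1, 2*n), (2*m, 2*n + 1)}"
      unfolding N_def by (rule hits_Suc_parent)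
    then show "c \<in> ch k" unfolding ch_def by (intro UN_I[of "(m, n)"]) auto
  qed
  have card_ch: "card (ch k) \<le> 3 * card (N k)" for k
  proof -
    have "card (ch k) \<le> (\<Sum>c\<in>N k. card (case c of (m, n) \<Rightarrow> {(2*m, 2*n), (2*m + 1, 2*n), (2*m, 2*n + 1)}))"
      unfolding ch_def by (rule card_UN_le) (rule fin)
    also have "\<dots> \<le> (\<Sum>c\<in>N k. 3)"
      by (rule sum_mono) (auto intro!: card_insert_le_m1 split: prod.splits)
    finally show ?thesis by simp
  qed
  \<comment> \<open>The part discarded between levels k and k + 1: subcells that miss F although
    their parent meets it.\<close>
  define D where "D k = (\<Union>c\<in>ch k - N (Suc k). cell_map (Suc k) c ` ?S)" for k
  have HD: "H (D k) \<le> ennreal (a k - a (Suc k)) * H ?S" for k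
  proof -
    have "real (card (ch k - N (Suc k))) \<le> 3 * real (card (N k)) - real (card (N (Suc k)))"
      using card_ch[of k] card_mono[OF fin(2) sub[of k]] by (simp add: card_Diff_subset[OF fin(1) sub])
    then have "card (ch k - N (Suc k)) / (3::real)^Suc k \<le>
        (3 * real (card (N k)) - real (card (N (Suc k)))) / 3^Suc k"
      by (rule divide_right_mono) simp
    also have "\<dots> = a k - a (Suc k)" by (simp add: a_def field_simps)
    finally have "ennreal (card (ch k - N (Suc k)) / 3^Suc k) * H ?S \<le> ennreal (a k - a (Suc k)) * H ?S"
      by (intro mult_right_mono ennreal_leI) auto
    moreover have "H (D k) \<le> ennreal (card (ch k - N (Suc k)) / 3^Suc k) * H ?S"
      unfolding D_def by (rule H_cells_le) (use fin in auto)
    ultimately show ?thesis by (rule order_trans[rotated])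
  qed
  have cover: "?S - F \<subseteq> (\<Union>k. D k)"
  proof
    fix x assume x: "x \<in> ?S - F"
    have "\<exists>k. x \<notin> (\<Union>c\<in>N k. cell_map k c ` ?S)"
    proof (rule ccontr)
      assume "\<not> ?thesis"
      then have in_cells: "x \<in> (\<Union>c\<in>N k. cell_map k c ` ?S)" for k by blast
      have "infdist x F \<le> 2 / 2^k" for k
      proof -
        obtain c y where c: "c \<in> N k" "y \<in> ?S" "x = cell_map k c y" using in_cells[of k] by blast
        then obtain z where z: "z \<in> ?S" "cell_map k c z \<in> F" by (auto simp: N_def hits_def)
        have "infdist x F \<le> dist x (cell_map k c z)" by (rule infdist_le[OF z(2)])
        also have "\<dots> \<le> 2 / 2^k" unfolding c(3) dist_cell_map
          by (intro divide_right_mono dist_gasket c z) auto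
        finally show ?thesis .
      qed
      moreover have "(\<lambda>k. 2 / 2^k :: real) \<longlonglongrightarrow> 0" by (rule LIMSEQ_divide_realpow_zero) simp
      ultimately have "infdist x F \<le> 0" by (intro LIMSEQ_le_const[of _ 0]) auto
      then have "infdist x F = 0" using infdist_nonneg[of x F] by linarith
      then show False using x in_closed_iff_infdist_zero[OF F(1,3)] by simp
    qed
    note ex = this
    define k where "k = (LEAST k. x \<notin> (\<Union>c\<in>N k. cell_map k c ` ?S))"
    have k: "x \<notin> (\<Union>c\<in>N k. cell_map k c ` ?S)" unfolding k_def by (rule LeastI_ex[OF ex])
    have least: "x \<in> (\<Union>c\<in>N j. cell_map j c ` ?S)" if "j < k" for j
      using not_less_Least[OF that[unfolded k_def]] by (rule notnotD)
    \<comment> \<open>The root cell meets F, so x is not lost at level 0; at the level just before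
      it is lost it still has a parent cell meeting F.\<close>
    have "?S \<inter> F \<noteq> {}" using F(2,3) by blast
    then have "N 0 = {(0, 0)}" by (auto simp: N_def hits_def)
    then have "k \<noteq> 0" using k x by (intro notI) auto
    then obtain j where j: "k = Suc j" by (cases k) auto
    then have "x \<in> (\<Union>c\<in>N j. cell_map j c ` ?S)" using least[of j] by simp
    then obtain m n y where y: "(m, n) \<in> N j" "y \<in> ?S" "x = cell_map j (m, n) y"
      by (elim UN_E imageE) (metis surj_pair)
    have "y \<in> hutchinson ?S" using y(2) by (simp add: hutchinson_gasket)
    then obtain i z where i: "i \<in> {0, 1, 2}" "z \<in> ?S" "y = gasket_map i z"
      unfolding hutchinson_def by blast
    obtain c where c: "c \<in> {(2*m, 2*n), (2*m + 1, 2*n), (2*m, 2*n + 1)}" "x = cell_map (Suc j) c z"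
      using i cell_map_gasket_map[of j m n z] y(3) by (metis insert_iff empty_iff)
    then have "c \<in> ch j" using y(1) unfolding ch_def by (intro UN_I[of "(m, n)"]) auto
    moreover have "c \<notin> N (Suc j)" using k c(2) i(2) unfolding j by blast
    ultimately have "x \<in> D j" unfolding D_def using c(2) i(2) by blast
    then show "x \<in> (\<Union>k. D k)" by blast
  qed
  have a0: "a 0 \<le> 1"
    unfolding a_def N_def using card_mono[of "{(0, 0)} :: (int \<times> int) set" "hits 0 F"]
    by (auto simp: hits_def)
  have alim: "a \<longlonglongrightarrow> measure nu F" using hits_tendsto_nu[OF F(1)] by (simp add: a_def[abs_def] N_def)
  have dec: "0 \<le> a k - a (Suc k)" for k
  proof -
    have "real (card (N (Suc k))) \<le> 3 * real (card (N k))"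
      using card_ch[of k] card_mono[OF fin(2) sub[of k]] by linarith
    then show ?thesis by (simp add: a_def field_simps)
  qed
  have "H (?S - F) \<le> H (\<Union>k. D k)" by (rule hausdorff_measure_mono[OF cover])
  also have "\<dots> \<le> (\<Sum>k. H (D k))" by (rule hausdorff_measure_UN_le)
  also have "\<dots> \<le> (\<Sum>k. ennreal (a k - a (Suc k)) * H ?S)"
    by (intro suminf_le HD) auto
  also have "\<dots> = (\<Sum>k. ennreal (a k - a (Suc k))) * H ?S" by simp
  also have "(\<Sum>k. ennreal (a k - a (Suc k))) = ennreal (a 0 - measure nu F)"
    using dec telescope_sums'[OF alim] by (intro suminf_ennreal_eq) auto
  also have "ennreal (a 0 - measure nu F) * H ?S \<le> ennreal (1 - measure nu F) * H ?S"
    using a0 by (intro mult_right_mono ennreal_leI) auto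
  finally show ?thesis .
qed

text \<open>F and its complement are bounded by complementary shares of H(S), and by subadditivity
  they add up to at least H(S). Since H(S) is finite, both bounds must be sharp; this replaces any
  measurability argument for H.\<close>

lemma H_eq_nu:
  assumes F: "closed F" "F \<subseteq> sierpinski_gasket"
  shows "H F = ennreal (measure nu F) * H sierpinski_gasket"
proof (cases "F = {}")
  case True
  then show ?thesis by (simp add: hausdorff_measure_empty)
next
  case False
  let ?S = sierpinski_gasket
  obtain h where h: "0 \<le> h" "H ?S = ennreal h" using H_gasket_finite by (cases "H ?S") auto
  have "H F < top"
    using H_le_nu[OF F] by (rule le_less_trans) (simp add: h flip: ennreal_mult)
  then obtain f where f: "0 \<le> f" "H F = ennreal f" by (cases "H F") auto
  define A where "A i = (if i then F else ?S - F)" for i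
  have "H ?S = H (\<Union>i\<in>UNIV. A i)" using F(2) by (intro arg_cong[of _ _ H]) (auto simp: A_def UNIV_bool)
  also have "\<dots> \<le> (\<Sum>i\<in>UNIV. H (A i))" by (rule hausdorff_measure_finite_UN_le) simp
  also have "\<dots> = H F + H (?S - F)" by (simp add: UNIV_bool A_def add.commute)
  also have "\<dots> \<le> H F + ennreal (1 - measure nu F) * H ?S"
    by (intro add_left_mono nu_complement_le_H F False)
  also have "\<dots> = ennreal (f + (1 - measure nu F) * h)"
    using h f by (subst ennreal_plus) (auto simp: ennreal_mult)
  finally have "h \<le> f + (1 - measure nu F) * h"
    unfolding h(2) using h(1) f(1) by (subst (asm) ennreal_le_iff) auto
  then have "ennreal (measure nu F * h) \<le> ennreal f" by (intro ennreal_leI) (simp add: algebra_simps)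
  then show ?thesis using H_le_nu[OF F] h f by (intro antisym) (auto simp: ennreal_mult)
qed

lemma H_Int_gasket:
  "closed A \<Longrightarrow> H (A \<inter> sierpinski_gasket) = ennreal (measure nu A) * H sierpinski_gasket"
  by (subst H_eq_nu) (auto simp: nu_Int_gasket borel_closed)

lemma gasket_mu_eq_nu:
  assumes "closed A"
  shows "gasket_mu A = ennreal (measure nu A)"
proof -
  show ?thesis
    unfolding gasket_mu_def H_Int_gasket[OF assms] using H_gasket_finite H_gasket_pos
    by (simp add: ennreal_mult_divide_eq less_top)
qed

section \<open>Symmetries and neighbour configurations\<close>

text \<open>The symmetry of \<open>nu\<close> is read off from Hausdorff measure, which an isometry
  cannot increase, rather than from an action on the digits.\<close>

lemma nu_isometry_le:
  assumes iso: "\<And>x y. dist (R x) (R y) = dist x y" and inv: "\<And>x. R (R x) = x"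
    and RS: "R ` sierpinski_gasket \<subseteq> sierpinski_gasket" and F: "closed F"
  shows "measure nu F \<le> measure nu (R -` F)"
proof -
  let ?S = sierpinski_gasket
  have "1-lipschitz_on UNIV R" by (rule lipschitz_onI) (simp_all add: iso)
  then have "closed (R -` F)"
    by (intro closed_vimage F) (rule lipschitz_on_continuous_on)
  have "F \<inter> ?S \<subseteq> R ` (R -` F \<inter> ?S)"
  proof
    fix x assume x: "x \<in> F \<inter> ?S"
    then have "R x \<in> R -` F \<inter> ?S" using RS by (auto simp: inv)
    then have "R (R x) \<in> R ` (R -` F \<inter> ?S)" by (rule imageI)
    then show "x \<in> R ` (R -` F \<inter> ?S)" by (simp add: inv)
  qed
  then have "H (F \<inter> ?S) \<le> H (R ` (R -` F \<inter> ?S))" by (rule hausdorff_measure_mono)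
  also have "\<dots> \<le> ennreal (1 powr gasket_dim) * H (R -` F \<inter> ?S)"
    using gasket_dim_pos by (intro hausdorff_measure_image_le) (simp_all add: iso)
  finally have "H (F \<inter> ?S) \<le> H (R -` F \<inter> ?S)" by simp
  then have "ennreal (measure nu F) * H ?S \<le> ennreal (measure nu (R -` F)) * H ?S"
    unfolding H_Int_gasket[OF F] H_Int_gasket[OF \<open>closed (R -` F)\<close>] .
  then have "ennreal (measure nu F) \<le> ennreal (measure nu (R -` F))"
    using H_gasket_pos H_gasket_finite by (simp add: ennreal_mult_le_mult_iff mult.commute)
  then show ?thesis by simp
qed

lemma nu_isometry_cball:
  assumes iso: "\<And>x y. dist (R x) (R y) = dist x y" and inv: "\<And>x. R (R x) = x"
    and RS: "R ` sierpinski_gasket \<subseteq> sierpinski_gasket"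
  shows "measure nu (cball (R y) r) = measure nu (cball y r)"
proof -
  have "dist (R y) x = dist y (R x)" for x y using iso[of y "R x"] by (simp add: inv)
  then have v: "R -` cball y r = cball (R y) r" for y by auto
  show ?thesis
    using nu_isometry_le[OF iso inv RS, of "cball y r"] nu_isometry_le[OF iso inv RS, of "cball (R y) r"]
    unfolding v inv by simp
qed

text \<open>\<open>hutchinson {R x}\<close> consists of the three images of \<open>R x\<close>, so
  the hypothesis says that R carries each map to one of the three. The image of the gasket is then
  contained in its own Hutchinson image.\<close>

lemma isometry_gasket_subset:
  assumes iso: "\<And>x y. dist (R x) (R y) = dist x y"
    and R: "\<And>i x. R (gasket_map i x) \<in> hutchinson {R x}"
  shows "R ` sierpinski_gasket \<subseteq> sierpinski_gasket"
proof (rule attractor_subset)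
  show "bounded (R ` sierpinski_gasket)"
    by (rule diameter_image_le(1)[of R 1])
       (simp_all add: iso compact_imp_bounded[OF compact_gasket])
  show "R ` sierpinski_gasket \<subseteq> hutchinson (R ` sierpinski_gasket)"
  proof
    fix y assume "y \<in> R ` sierpinski_gasket"
    then obtain x where x: "x \<in> sierpinski_gasket" "y = R x" by blast
    then have "x \<in> hutchinson sierpinski_gasket" by (simp add: hutchinson_gasket)
    then obtain i x' where x': "x' \<in> sierpinski_gasket" "x = gasket_map i x'"
      unfolding hutchinson_def by blast
    have "hutchinson {R x'} \<subseteq> hutchinson (R ` sierpinski_gasket)"
      using x'(1) unfolding hutchinson_def by blast
    then show "y \<in> hutchinson (R ` sierpinski_gasket)" using R[of i x'] x(2) x'(2) by blast
  qed
qed (simp_all add: hutchinson_gasket)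

text \<open>Reflection in the vertical line through (1/2, 0), exchanging the vertices fixed by maps
  0 and 1.\<close>

definition refl01 :: "real^2 \<Rightarrow> real^2" where
  "refl01 x = vector [1 - x $ 1, x $ 2]"

text \<open>Reflection in the line through the origin at 30 degrees, exchanging the vertices fixed
  by maps 1 and 2. The two reflections generate the symmetry group of the triangle.\<close>

definition refl12 :: "real^2 \<Rightarrow> real^2" where
  "refl12 x = vector [x $ 1 / 2 + sqrt 3 / 2 * x $ 2, sqrt 3 / 2 * x $ 1 - x $ 2 / 2]"

lemma dist_real2: "dist (x :: real^2) y = sqrt ((x $ 1 - y $ 1)\<^sup>2 + (x $ 2 - y $ 2)\<^sup>2)"
  by (simp add: dist_norm norm_vec_def L2_set_def sum_2)

lemma dist_refl01: "dist (refl01 x) (refl01 y) = dist x y"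
  by (simp add: dist_real2 refl01_def power2_commute)

lemma dist_refl12: "dist (refl12 x) (refl12 y) = dist x y"
proof -
  define a b where "a = x $ 1 - y $ 1" and "b = x $ 2 - y $ 2"
  have "(a / 2 + sqrt 3 / 2 * b)\<^sup>2 + (sqrt 3 / 2 * a - b / 2)\<^sup>2 = a\<^sup>2 + b\<^sup>2"
    by (simp add: power2_sum power2_diff power_mult_distrib power_divide)
  moreover have "refl12 x $ 1 - refl12 y $ 1 = a / 2 + sqrt 3 / 2 * b"
    "refl12 x $ 2 - refl12 y $ 2 = sqrt 3 / 2 * a - b / 2"
    by (simp_all add: refl12_def a_def b_def algebra_simps add_divide_distrib diff_divide_distrib)
  ultimately show ?thesis unfolding dist_real2 by (simp add: a_def b_def)
qed

lemma refl01_refl01: "refl01 (refl01 x) = x"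
  by (simp add: refl01_def vec_eq_iff forall_2)

lemma refl12_refl12: "refl12 (refl12 x) = x"
proof -
  have *: "sqrt 3 * (sqrt 3 * t) = 3 * t" for t by (simp flip: mult.assoc)
  show ?thesis
    by (simp add: refl12_def vec_eq_iff forall_2 algebra_simps add_divide_distrib diff_divide_distrib)
       (simp add: *)
qed

lemma refl01_gasket: "refl01 ` sierpinski_gasket \<subseteq> sierpinski_gasket"
proof (rule isometry_gasket_subset[OF dist_refl01])
  fix i x
  have "refl01 (gasket_map 0 x) = gasket_map 1 (refl01 x)"
    "refl01 (gasket_map 1 x) = gasket_map 0 (refl01 x)"
    "refl01 (gasket_map 2 x) = gasket_map 2 (refl01 x)"
    by (simp_all add: refl01_def gasket_map_def gasket_shift_def vec_eq_iff forall_2 field_simps)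
  then show "refl01 (gasket_map i x) \<in> hutchinson {refl01 x}"
    using gasket_map_cases[of i] unfolding hutchinson_def by auto
qed

lemma refl12_gasket: "refl12 ` sierpinski_gasket \<subseteq> sierpinski_gasket"
proof (rule isometry_gasket_subset[OF dist_refl12])
  fix i x
  have "refl12 (gasket_map 0 x) = gasket_map 0 (refl12 x)"
    "refl12 (gasket_map 1 x) = gasket_map 2 (refl12 x)"
    "refl12 (gasket_map 2 x) = gasket_map 1 (refl12 x)"
    by (simp_all add: refl12_def gasket_map_def gasket_shift_def vec_eq_iff forall_2
        algebra_simps add_divide_distrib diff_divide_distrib)
  then show "refl12 (gasket_map i x) \<in> hutchinson {refl12 x}"
    using gasket_map_cases[of i] unfolding hutchinson_def by auto
qed

text \<open>The total mass that a ball of radius D about y has in the translates of the gasket by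
  the lattice vectors of N, each translate carrying mass 1.\<close>

definition offset_sum :: "real^2 \<Rightarrow> real \<Rightarrow> (int \<times> int) set \<Rightarrow> real" where
  "offset_sum y D N = (\<Sum>d\<in>N. measure nu (cball (y - lattice_vec d) D))"

text \<open>The map on offsets is the linear part of \<open>refl01\<close> in lattice coordinates:
  translation by d becomes, after reflection, translation by the reflected vector.\<close>

lemma offset_sum_refl01:
  "offset_sum (refl01 y) D ((\<lambda>(p, q). (- p - q, q)) ` N) = offset_sum y D N"
proof -
  have "refl01 y - lattice_vec (- p - q, q) = refl01 (y - lattice_vec (p, q))" for p q
    by (simp add: refl01_def lattice_vec_def vec_eq_iff forall_2 field_simps)
  moreover have "inj_on (\<lambda>(p, q). (- p - q, q :: int)) N" by (auto simp: inj_on_def)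
  ultimately show ?thesis
    unfolding offset_sum_def
    by (simp add: sum.reindex case_prod_unfold
        nu_isometry_cball[OF dist_refl01 refl01_refl01 refl01_gasket])
qed

lemma offset_sum_refl12:
  "offset_sum (refl12 y) D ((\<lambda>(p, q). (q, p)) ` N) = offset_sum y D N"
proof -
  have "refl12 y - lattice_vec (q, p) = refl12 (y - lattice_vec (p, q))" for p q
    by (simp add: refl12_def lattice_vec_def vec_eq_iff forall_2
        algebra_simps add_divide_distrib diff_divide_distrib)
  moreover have "inj_on (\<lambda>(p, q). (q, p :: int)) N" by (auto simp: inj_on_def)
  ultimately show ?thesis
    unfolding offset_sum_def
    by (simp add: sum.reindex case_prod_unfold
        nu_isometry_cball[OF dist_refl12 refl12_refl12 refl12_gasket])
qed

section \<open>Which cells can touch a given cell\<close>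

lemma cells_Suc_iff:
  "(m, n) \<in> cells (Suc k) \<longleftrightarrow> (m div 2, n div 2) \<in> cells k \<and> (even m \<or> even n)"
proof
  assume "(m, n) \<in> cells (Suc k)"
  then show "(m div 2, n div 2) \<in> cells k \<and> (even m \<or> even n)"
    by (auto simp: cells.simps(2))
next
  assume *: "(m div 2, n div 2) \<in> cells k \<and> (even m \<or> even n)"
  have "(m, n) \<in> {(2 * (m div 2), 2 * (n div 2)), (2 * (m div 2) + 1, 2 * (n div 2)),
      (2 * (m div 2), 2 * (n div 2) + 1)}"
    using *[THEN conjunct2] by simp presburger
  with * show "(m, n) \<in> cells (Suc k)"
    unfolding cells.simps(2) by (intro UN_I[of "(m div 2, n div 2)"]) auto
qed

lemma parity_cases:
  fixes m n :: int
  assumes "even m \<or> even n"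
  obtains a b where "m = 2 * a" "n = 2 * b" | a b where "m = 2 * a + 1" "n = 2 * b"
  | a b where "m = 2 * a" "n = 2 * b + 1"
  using assms by (meson evenE oddE)

text \<open>Each conjunct concerns one vertex of the cell and the two positions in which another cell
  could touch it there.\<close>

lemma cells_vertex_nbr:
  "(m, n) \<in> cells k \<Longrightarrow> \<not> ((m - 1, n) \<in> cells k \<and> (m, n - 1) \<in> cells k)
    \<and> \<not> ((m + 1, n) \<in> cells k \<and> (m + 1, n - 1) \<in> cells k)
    \<and> \<not> ((m, n + 1) \<in> cells k \<and> (m - 1, n + 1) \<in> cells k)"
proof (induction k arbitrary: m n)
  case 0
  then show ?case by simp
next
  case (Suc k)
  have div: "(2 * a - 1) div 2 = a - 1" "(2 * a + 1) div 2 = a" "(2 * a + 2) div 2 = a + 1"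
    for a :: int by presburger+
  have par: "even m \<or> even n" and par': "(m div 2, n div 2) \<in> cells k"
    using Suc.prems by (auto simp: cells_Suc_iff)
  \<comment> \<open>A child shares one vertex with its parent, and there the claim is inherited. At
    its other two vertices it touches a sibling, and the competing position has two odd
    coordinates.\<close>
  from par show ?case
  proof (cases rule: parity_cases)
    case (1 a b)
    then show ?thesis using Suc.IH[of a b] par' by (auto simp: cells_Suc_iff div)
  next
    case (2 a b)
    then show ?thesis using Suc.IH[of a b] par' by (auto simp: cells_Suc_iff div add.assoc)
  next
    case (3 a b)
    then show ?thesis using Suc.IH[of a b] par' by (auto simp: cells_Suc_iff div add.assoc)
  qed
qed

text \<open>The relative positions of the level-two cells touching \<open>S\<^sub>0\<^sub>1\<close>, which has offset \<open>(1, 0)\<close>.\<close>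

definition offset_config :: "(int \<times> int) set" where
  "offset_config = {(0, 0), (-1, 0), (-1, 1), (1, 0)}"

text \<open>Three places of a cell in its parent times two choices at the outer vertex: the parities
  leave the siblings at two vertices, and at the third only one of the two possible neighbours can
  exist.\<close>

lemma nbr_offsets_cases:
  assumes c: "c \<in> cells (Suc k)"
  obtains
    "nbr_offsets (Suc k) c \<subseteq> {(0, 0), (1, 0), (0, 1), (-1, 0)}"
  | "nbr_offsets (Suc k) c \<subseteq> {(0, 0), (1, 0), (0, 1), (0, -1)}"
  | "nbr_offsets (Suc k) c \<subseteq> {(0, 0), (-1, 0), (-1, 1), (1, 0)}"
  | "nbr_offsets (Suc k) c \<subseteq> {(0, 0), (-1, 0), (-1, 1), (1, -1)}"
  | "nbr_offsets (Suc k) c \<subseteq> {(0, 0), (0, -1), (1, -1), (0, 1)}"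
  | "nbr_offsets (Suc k) c \<subseteq> {(0, 0), (0, -1), (1, -1), (-1, 1)}"
proof -
  obtain m n where mn: "c = (m, n)" by (cases c)
  note v = cells_vertex_nbr[OF c[unfolded mn]]
  from c have par: "even m \<or> even n" by (simp add: mn cells_Suc_iff)
  have nb: "d \<in> nbr_offsets (Suc k) c \<longleftrightarrow>
      d \<in> near_offsets \<and> (m + fst d, n + snd d) \<in> cells (Suc k)" for d
    by (cases d) (simp add: nbr_offsets_def mn)
  have odd: "(m', n') \<notin> cells (Suc k)" if "odd m'" "odd n'" for m' n'
    using that by (simp add: cells_Suc_iff)
  from par show ?thesis
  proof (cases rule: parity_cases)
    case (1 a b)
    have "nbr_offsets (Suc k) c \<subseteq> {(0, 0), (1, 0), (0, 1), (-1, 0), (0, -1)}"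
      using odd[of "m + 1" "n - 1"] odd[of "m - 1" "n + 1"] 1
      by (auto simp: nb near_offsets_def)
    moreover have "\<not> ((-1, 0) \<in> nbr_offsets (Suc k) c \<and> (0, -1) \<in> nbr_offsets (Suc k) c)"
      using v by (simp add: nb)
    ultimately show ?thesis using that(1,2) by blast
  next
    case (2 a b)
    have "nbr_offsets (Suc k) c \<subseteq> {(0, 0), (-1, 0), (-1, 1), (1, 0), (1, -1)}"
      using odd[of m "n - 1"] odd[of m "n + 1"] 2
      by (auto simp: nb near_offsets_def)
    moreover have "\<not> ((1, 0) \<in> nbr_offsets (Suc k) c \<and> (1, -1) \<in> nbr_offsets (Suc k) c)"
      using v by (simp add: nb)
    ultimately show ?thesis using that(3,4) by blast
  next
    case (3 a b)
    have "nbr_offsets (Suc k) c \<subseteq> {(0, 0), (0, -1), (1, -1), (0, 1), (-1, 1)}"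
      using odd[of "m - 1" n] odd[of "m + 1" n] 3
      by (auto simp: nb near_offsets_def)
    moreover have "\<not> ((0, 1) \<in> nbr_offsets (Suc k) c \<and> (-1, 1) \<in> nbr_offsets (Suc k) c)"
      using v by (simp add: nb)
    ultimately show ?thesis using that(5,6) by blast
  qed
qed

text \<open>The six possible neighbourhoods form one orbit under the symmetry group of the triangle,
  which has order six. The words in the two reflections list its elements, and the third case is the
  identity.\<close>

lemma nbr_offsets_config:
  assumes c: "c \<in> cells (Suc k)" and y: "y \<in> sierpinski_gasket"
  obtains N y' where "finite N" "nbr_offsets (Suc k) c \<subseteq> N" "y' \<in> sierpinski_gasket"
    "offset_sum y D N = offset_sum y' D offset_config"
proof -
  let ?S = sierpinski_gasket
  have r: "refl01 z \<in> ?S" "refl12 z \<in> ?S" if "z \<in> ?S" for z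
    using refl01_gasket refl12_gasket that by auto
  let ?m = "(\<lambda>(p, q). (- p - q, q)) :: int \<times> int \<Rightarrow> int \<times> int"
  let ?w = "(\<lambda>(p, q). (q, p)) :: int \<times> int \<Rightarrow> int \<times> int"
  note s1 = offset_sum_refl01[of _ D, symmetric] and s2 = offset_sum_refl12[of _ D, symmetric]
  from c show ?thesis
  proof (cases rule: nbr_offsets_cases)
    case 1
    have "offset_sum y D {(0, 0), (1, 0), (0, 1), (-1, 0)} = offset_sum (refl01 y) D offset_config"
      by (subst s1) (simp add: offset_config_def insert_commute)
    then show ?thesis using 1 y r by (intro that[of "{(0, 0), (1, 0), (0, 1), (-1, 0)}" "refl01 y"]) auto
  next
    case 2
    have "offset_sum y D {(0, 0), (1, 0), (0, 1), (0, -1)} =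
        offset_sum (refl01 (refl12 y)) D offset_config"
      by (subst s2, subst s1) (simp add: offset_config_def insert_commute)
    then show ?thesis using 2 y r
      by (intro that[of "{(0, 0), (1, 0), (0, 1), (0, -1)}" "refl01 (refl12 y)"]) auto
  next
    case 3
    then show ?thesis using y by (intro that[of offset_config y]) (auto simp: offset_config_def)
  next
    case 4
    have "offset_sum y D {(0, 0), (-1, 0), (-1, 1), (1, -1)} =
        offset_sum (refl12 (refl01 (refl12 y))) D offset_config"
      by (subst s2, subst s1, subst s2) (simp add: offset_config_def insert_commute)
    then show ?thesis using 4 y r
      by (intro that[of "{(0, 0), (-1, 0), (-1, 1), (1, -1)}" "refl12 (refl01 (refl12 y))"]) auto
  next
    case 5
    have "offset_sum y D {(0, 0), (0, -1), (1, -1), (0, 1)} =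
        offset_sum (refl12 y) D offset_config"
      by (subst s2) (simp add: offset_config_def insert_commute)
    then show ?thesis using 5 y r
      by (intro that[of "{(0, 0), (0, -1), (1, -1), (0, 1)}" "refl12 y"]) auto
  next
    case 6
    have "offset_sum y D {(0, 0), (0, -1), (1, -1), (-1, 1)} =
        offset_sum (refl12 (refl01 y)) D offset_config"
      by (subst s1, subst s2) (simp add: offset_config_def insert_commute)
    then show ?thesis using 6 y r
      by (intro that[of "{(0, 0), (0, -1), (1, -1), (-1, 1)}" "refl12 (refl01 y)"]) auto
  qed
qed

section \<open>Densities of balls\<close>

definition ball_density :: "real^2 \<Rightarrow> real \<Rightarrow> real" where
  "ball_density x d = measure nu (cball x d) / (2 * d) powr gasket_dim"

lemma gasket_cell01:
  "gasket_map 0 ` gasket_map 1 ` sierpinski_gasket = cell_map 2 (1, 0) ` sierpinski_gasket"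
proof -
  have "gasket_map 0 (gasket_map 1 z) = cell_map 2 (1, 0) z" for z
    using cell_map_gasket_map(1)[of 0 0 0 "gasket_map 1 z"] cell_map_gasket_map(2)[of 1 0 0 z]
    by (simp add: numeral_2_eq_2 del: One_nat_def) simp
  then show ?thesis by (simp only: image_image)
qed

lemma cell01_in_gasket: "cell_map 2 (1, 0) ` sierpinski_gasket \<subseteq> sierpinski_gasket"
proof -
  have "(1, 0) \<in> cells 2" by (simp add: numeral_2_eq_2 cells_Suc_iff)
  then show ?thesis by (auto intro: cell_map_in_gasket)
qed

text \<open>Mass and (2 d)^s both change by the factor 3 per level, so transporting the picture from
  level k to level 2 preserves density. It can only gain, since neighbours missing around x may be
  present around S_01.\<close>

lemma density_le_density_cell01:
  assumes x: "x \<in> sierpinski_gasket" and d: "0 < d" "d < sqrt 3 / 4"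
  obtains x' d' where "x' \<in> cell_map 2 (1, 0) ` sierpinski_gasket" "sqrt 3 / 16 \<le> d'" "d' \<le> sqrt 3 / 8"
    "ball_density x d \<le> ball_density x' d'"
proof -
  \<comment> \<open>The shift from j to k = j + 1 keeps the level positive, so that the cell has a
    parent and the parity classification of neighbours applies.\<close>
  obtain j where j: "sqrt 3 / 4 / 2 / 2^j \<le> d" "d < sqrt 3 / 4 / 2^j"
    using dyadic_scale[OF d] .
  define k where "k = Suc j"
  have k: "sqrt 3 / 4 / 2^k \<le> d" "d < sqrt 3 / 2 / 2^k" using j by (simp_all add: k_def)
  obtain c y where c: "c \<in> cells k" "y \<in> sierpinski_gasket" "x = cell_map k c y"
    using gasket_cellE[OF x] .
  define D where "D = 2^k * d"
  obtain N y' where N: "finite N" "nbr_offsets k c \<subseteq> N" "y' \<in> sierpinski_gasket"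
    "offset_sum y D N = offset_sum y' D offset_config"
    using nbr_offsets_config[of c j y D] c unfolding k_def by blast
  define x' where "x' = cell_map 2 (1, 0) y'"
  have "measure nu (cball x d) \<le> offset_sum y D N / 3^k"
    using nu_cball_le[OF c(2) k(2) N(1,2)] by (simp add: c(3) offset_sum_def D_def)
  also have "\<dots> = offset_sum y' D offset_config / 3^k" by (simp add: N(4))
  finally have 1: "measure nu (cball x d) \<le> offset_sum y' D offset_config / 3^k" .
  \<comment> \<open>Around S_01 all four positions are occupied, so the full configuration also
    bounds the mass from below.\<close>
  have "(+) (1, 0) ` offset_config \<subseteq> cells 2"
    by (simp add: offset_config_def numeral_2_eq_2 cells_Suc_iff)
  from nu_cball_ge[OF this, of y' "D / 4"]
  have 2: "offset_sum y' D offset_config / 9 \<le> measure nu (cball x' (D / 4))"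
    by (simp add: x'_def offset_sum_def power2_eq_square)
  have D: "0 < D" using d by (simp add: D_def)
  have "ball_density x d = measure nu (cball x d) / ((2 * D / 2^k) powr gasket_dim)"
    by (simp add: ball_density_def D_def)
  also have "\<dots> = measure nu (cball x d) * 3^k / (2 * D) powr gasket_dim"
    using D by (subst powr_gasket_dim_scale) auto
  also have "\<dots> \<le> offset_sum y' D offset_config / (2 * D) powr gasket_dim"
    using 1 D by (intro divide_right_mono) (simp_all add: field_simps)
  also have "\<dots> \<le> measure nu (cball x' (D / 4)) * 9 / (2 * D) powr gasket_dim"
    using 2 D by (intro divide_right_mono) (simp_all add: field_simps)
  also have "\<dots> = measure nu (cball x' (D / 4)) / ((2 * D / 2^2) powr gasket_dim)"
    using D by (subst powr_gasket_dim_scale) auto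
  also have "\<dots> = ball_density x' (D / 4)" by (simp add: ball_density_def)
  finally have "ball_density x d \<le> ball_density x' (D / 4)" .
  moreover have "sqrt 3 / 16 \<le> D / 4" "D / 4 \<le> sqrt 3 / 8"
    using k by (simp_all add: D_def field_simps)
  moreover have "x' \<in> cell_map 2 (1, 0) ` sierpinski_gasket" using N(3) by (simp add: x'_def)
  ultimately show ?thesis using that by blast
qed

text \<open>Eventually all the balls lie in the ball of radius r + e about x, and these enlarged
  balls decrease to the limit ball. The lower bounds a n are separate because the masses themselves
  need not converge.\<close>

lemma nu_cball_upper_semicontinuous:
  assumes X: "X \<longlonglongrightarrow> x" and R: "R \<longlonglongrightarrow> r"
    and a: "a \<longlonglongrightarrow> L" "\<And>n. a n \<le> measure nu (cball (X n) (R n))"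
  shows "L \<le> measure nu (cball x r)"
proof -
  have le: "L \<le> measure nu (cball x (r + e))" if e: "0 < e" for e
  proof -
    have "\<forall>\<^sub>F n in sequentially. dist (X n) x < e / 2" "\<forall>\<^sub>F n in sequentially. dist (R n) r < e / 2"
      using X R e by (auto dest!: tendstoD[of _ _ _ "e / 2"])
    then have "\<forall>\<^sub>F n in sequentially. a n \<le> measure nu (cball x (r + e))"
    proof eventually_elim
      case (elim n)
      have "cball (X n) (R n) \<subseteq> cball x (r + e)"
      proof
        fix z assume "z \<in> cball (X n) (R n)"
        then have "dist (X n) z \<le> R n" by simp
        moreover have "dist x (X n) < e / 2" using elim by (simp add: dist_commute)
        moreover have "R n < r + e / 2"
          using elim(2) abs_ge_self[of "R n - r"] unfolding dist_real_def by linarith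
        ultimately show "z \<in> cball x (r + e)" using dist_triangle[of x z "X n"] by simp
      qed
      then have "measure nu (cball (X n) (R n)) \<le> measure nu (cball x (r + e))"
        by (rule nu.finite_measure_mono) simp
      then show ?case using a(2)[of n] by linarith
    qed
    then show ?thesis using a(1) by (intro tendsto_upperbound[OF a(1)]) auto
  qed
  let ?B = "\<lambda>m. cball x (r + 1 / real (Suc m))"
  have "(\<Inter>m. ?B m) = cball x r"
  proof
    show "(\<Inter>m. ?B m) \<subseteq> cball x r"
    proof
      fix z assume "z \<in> (\<Inter>m. ?B m)"
      then have "dist x z \<le> r + 1 / real (Suc m)" for m by auto
      moreover have "(\<lambda>m. r + 1 / real (Suc m)) \<longlonglongrightarrow> r + 0"
        using LIMSEQ_inverse_real_of_nat by (intro tendsto_intros) (simp add: inverse_eq_divide)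
      ultimately have "dist x z \<le> r + 0" by (intro LIMSEQ_le_const) auto
      then show "z \<in> cball x r" by simp
    qed
    show "cball x r \<subseteq> (\<Inter>m. ?B m)" by (intro INT_greatest subset_cball) simp
  qed
  moreover have "(\<lambda>m. measure nu (?B m)) \<longlonglongrightarrow> measure nu (\<Inter>m. ?B m)"
  proof (rule nu.finite_Lim_measure_decseq)
    show "decseq ?B"
      by (rule decseq_SucI) (intro subset_cball add_left_mono divide_left_mono, auto)
  qed auto
  ultimately have "(\<lambda>m. measure nu (?B m)) \<longlonglongrightarrow> measure nu (cball x r)" by simp
  from LIMSEQ_le_const[OF this] le show ?thesis by simp
qed

lemma density_attains_max:
  assumes K: "compact K" "K \<noteq> {}" and ab: "0 < a" "a \<le> b"
  obtains x d where "x \<in> K" "a \<le> d" "d \<le> b"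
    "\<And>y e. y \<in> K \<Longrightarrow> a \<le> e \<Longrightarrow> e \<le> b \<Longrightarrow> ball_density y e \<le> ball_density x d"
proof -
  let ?D = "(\<lambda>(x, d). ball_density x d) ` (K \<times> {a..b})"
  have ne: "?D \<noteq> {}" using K ab by auto
  have bd: "ball_density y e \<le> 1 / (2 * a) powr gasket_dim" if "a \<le> e" for y e
    unfolding ball_density_def using that ab gasket_dim_pos
    by (intro frac_le powr_mono2) auto
  then have bdd: "bdd_above ?D" by (intro bdd_aboveI[of _ "1 / (2 * a) powr gasket_dim"]) auto
  define L where "L = Sup ?D"
  have "\<exists>p. p \<in> K \<times> {a..b} \<and> L - 1 / real (Suc n) < ball_density (fst p) (snd p)" for n
    using less_cSupD[OF ne, of "L - 1 / real (Suc n)"] unfolding L_def by fastforce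
  then obtain p where p: "\<And>n. p n \<in> K \<times> {a..b}"
    "\<And>n. L - 1 / real (Suc n) < ball_density (fst (p n)) (snd (p n))"
    by metis
  have "compact (K \<times> {a..b})" using K(1) by (intro compact_Times) auto
  then obtain q s where q: "q \<in> K \<times> {a..b}" "strict_mono s" "(p \<circ> s) \<longlonglongrightarrow> q"
    using p(1) unfolding compact_def by metis
  obtain x d where xd: "q = (x, d)" by (cases q)
  have lim: "(\<lambda>n. fst (p (s n))) \<longlonglongrightarrow> x" "(\<lambda>n. snd (p (s n))) \<longlonglongrightarrow> d"
    using tendsto_fst[OF q(3)] tendsto_snd[OF q(3)] by (simp_all add: xd o_def)
  have d: "a \<le> d" "d \<le> b" "x \<in> K" using q(1) xd by auto
  have inv0: "(\<lambda>n. 1 / real (Suc n)) \<longlonglongrightarrow> 0"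
    using LIMSEQ_inverse_real_of_nat by (simp add: inverse_eq_divide)
  \<comment> \<open>Multiplying by (2 d)^s turns almost maximal densities into convergent lower
    bounds for masses of balls.\<close>
  have lim': "(\<lambda>n. (L - 1 / real (Suc (s n))) * (2 * snd (p (s n))) powr gasket_dim)
      \<longlonglongrightarrow> (L - 0) * (2 * d) powr gasket_dim"
    using d ab LIMSEQ_subseq_LIMSEQ[OF inv0 q(2)]
    by (intro tendsto_intros lim) (auto simp: o_def)
  have "(L - 1 / real (Suc (s n))) * (2 * snd (p (s n))) powr gasket_dim \<le>
      measure nu (cball (fst (p (s n))) (snd (p (s n))))" for n
  proof -
    have "0 < snd (p (s n))" using p(1)[of "s n"] ab by auto
    then show ?thesis using p(2)[of "s n"] by (simp add: ball_density_def less_divide_eq)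
  qed
  from nu_cball_upper_semicontinuous[OF lim lim' this]
  have "L * (2 * d) powr gasket_dim \<le> measure nu (cball x d)" by simp
  then have "L \<le> ball_density x d" using d ab by (simp add: ball_density_def le_divide_eq)
  moreover have "ball_density y e \<le> L" if "y \<in> K" "a \<le> e" "e \<le> b" for y e
    unfolding L_def using that by (intro cSup_upper[OF _ bdd]) force
  ultimately show ?thesis using that[of x d] d by force
qed

text \<open>A cell through x of diameter below d lies in the ball and has mass at least
  3^-k.\<close>

lemma nu_cball_pos:
  assumes x: "x \<in> sierpinski_gasket" and d: "0 < d"
  shows "0 < measure nu (cball x d)"
proof -
  have "(\<lambda>k. 2 / 2^k :: real) \<longlonglongrightarrow> 0" by (rule LIMSEQ_divide_realpow_zero) simp
  from order_tendstoD(2)[OF this, of d] d obtain k where k: "2 / 2^k < d"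
    by (auto simp: eventually_sequentially)
  obtain c y where c: "c \<in> cells k" "y \<in> sierpinski_gasket" "x = cell_map k c y"
    using gasket_cellE[OF x] .
  have "sierpinski_gasket \<subseteq> cell_map k c -` cball x d"
  proof
    fix z assume "z \<in> sierpinski_gasket"
    then have "dist y z / 2^k \<le> 2 / 2^k" using dist_gasket c(2) by (intro divide_right_mono) auto
    then show "z \<in> cell_map k c -` cball x d" using k by (simp add: c(3) dist_cell_map)
  qed
  then have "1 = measure nu (cell_map k c -` cball x d)"
    by (intro nu_superset_gasket[symmetric] vimage_borel) auto
  also have "\<dots> \<le> (\<Sum>c\<in>cells k. measure nu (cell_map k c -` cball x d))"
    by (rule member_le_sum[OF c(1)]) auto
  finally have "1 / 3^k \<le> measure nu (cball x d)"
    by (subst nu_cells[of _ k]) (auto intro!: divide_right_mono)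
  then show ?thesis by (rule less_le_trans[rotated]) simp
qed

section \<open>Covers by balls centred in a closed subset\<close>

text \<open>Finite sets of pairs of centre and radius are easy to unite over successive rounds; the
  passage to infinite sequences is made once at the end. The radius bound is half of \<delta>
  because the premeasure restricts diameters.\<close>

definition ball_cover :: "real \<Rightarrow> (real^2) set \<Rightarrow> ((real^2) \<times> real) set \<Rightarrow> bool" where
  "ball_cover \<delta> F G \<longleftrightarrow> finite G \<and> G \<subseteq> F \<times> {0<..\<delta>/2} \<and> F \<subseteq> (\<Union>(x, d)\<in>G. cball x d)"

definition cover_cost :: "((real^2) \<times> real) set \<Rightarrow> real" where
  "cover_cost G = (\<Sum>(x, d)\<in>G. (2 * d) powr gasket_dim)"

lemma cover_cost_Un: "finite G \<Longrightarrow> finite G' \<Longrightarrow> cover_cost (G \<union> G') \<le> cover_cost G + cover_cost G'"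
  unfolding cover_cost_def by (subst sum_Un) (auto intro!: sum_nonneg)

lemma cover_cost_image:
  assumes "finite I"
  shows "cover_cost ((\<lambda>c. (z c, r)) ` I) \<le> card I * (2 * r) powr gasket_dim"
proof -
  have "cover_cost ((\<lambda>c. (z c, r)) ` I) = (\<Sum>p\<in>(\<lambda>c. (z c, r)) ` I. (2 * r) powr gasket_dim)"
    unfolding cover_cost_def by (rule sum.cong) auto
  also have "\<dots> \<le> card I * (2 * r) powr gasket_dim"
    using card_image_le[OF assms, of "\<lambda>c. (z c, r)"] by (simp add: mult_right_mono)
  finally show ?thesis .
qed

lemma fine_level:
  assumes F: "closed F" and e: "0 < (e :: real)" and r: "0 < (\<delta> :: real)"
  obtains k where "card (hits k F) / 3^k \<le> measure nu F + e" "r / 2^k \<le> \<delta>"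
proof -
  have "(\<lambda>k. r / 2^k :: real) \<longlonglongrightarrow> 0" by (rule LIMSEQ_divide_realpow_zero) simp
  then have 1: "\<forall>\<^sub>F k in sequentially. r / 2^k < \<delta>" using r by (rule order_tendstoD)
  have 2: "\<forall>\<^sub>F k in sequentially. card (hits k F) / 3^k < measure nu F + e"
    using hits_tendsto_nu[OF F] by (rule order_tendstoD) (use e in simp)
  obtain k where "r / 2^k < \<delta>" "card (hits k F) / 3^k < measure nu F + e"
    using eventually_happens[OF eventually_conj[OF 1 2]] by auto
  then show ?thesis by (intro that[of k]) auto
qed

text \<open>A ball of radius 2 / 2^k about a point of F in a cell swallows the cell, at cost (4 /
  2^k)^s = 9 / 3^k; hence the 9. If F has mass 0, the cost is arbitrarily small.\<close>

lemma crude_ball_cover: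
  assumes F: "closed F" "F \<subseteq> sierpinski_gasket" and \<delta>: "0 < \<delta>" and \<gamma>: "0 < \<gamma>"
  obtains G where "ball_cover \<delta> F G" "cover_cost G \<le> 9 * measure nu F + \<gamma>"
proof -
  obtain k where k: "card (hits k F) / 3^k \<le> measure nu F + \<gamma> / 9" "2 / 2^k \<le> \<delta> / 2"
    using fine_level[OF F(1), of "\<gamma> / 9" "\<delta> / 2" 2] \<gamma> \<delta> by auto
  have "\<forall>c\<in>hits k F. \<exists>y. y \<in> sierpinski_gasket \<and> cell_map k c y \<in> F"
    unfolding hits_def by blast
  then obtain y where y: "\<And>c. c \<in> hits k F \<Longrightarrow> y c \<in> sierpinski_gasket"
    "\<And>c. c \<in> hits k F \<Longrightarrow> cell_map k c (y c) \<in> F" by metis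
  define G where "G = (\<lambda>c. (cell_map k c (y c), 2 / 2^k :: real)) ` hits k F"
  have "ball_cover \<delta> F G"
    unfolding ball_cover_def
  proof (intro conjI)
    show "G \<subseteq> F \<times> {0<..\<delta>/2}" using k y by (auto simp: G_def)
    show "F \<subseteq> (\<Union>(x, d)\<in>G. cball x d)"
    proof
      fix x assume x: "x \<in> F"
      obtain c z where c: "c \<in> cells k" "z \<in> sierpinski_gasket" "x = cell_map k c z"
        using gasket_cellE[of x k] x F(2) by blast
      then have h: "c \<in> hits k F" using x unfolding hits_def by blast
      have "dist (cell_map k c (y c)) x \<le> 2 / 2^k"
        unfolding c(3) dist_cell_map by (intro divide_right_mono dist_gasket y h c) simp
      then show "x \<in> (\<Union>(x, d)\<in>G. cball x d)"
        unfolding G_def using h by (intro UN_I[of "(cell_map k c (y c), 2 / 2^k)"]) auto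
    qed
  qed (simp add: G_def)
  moreover have "cover_cost G \<le> 9 * measure nu F + \<gamma>"
  proof -
    have "cover_cost G \<le> card (hits k F) * (2 * (2 / 2^k)) powr gasket_dim"
      unfolding G_def by (rule cover_cost_image) simp
    also have "(2 * (2 / 2^k)) powr gasket_dim = ((2::real)^2 / 2^k) powr gasket_dim" by simp
    also have "\<dots> = 9 / 3^k"
      by (subst powr_gasket_dim_scale) (simp_all only: power_two_powr_gasket_dim, simp_all)
    also have "card (hits k F) * (9 / 3^k) = 9 * (card (hits k F) / 3^k)" by simp
    also have "\<dots> \<le> 9 * (measure nu F + \<gamma> / 9)" by (intro mult_left_mono k) simp
    also have "\<dots> = 9 * measure nu F + \<gamma>" by simp
    finally show ?thesis .
  qed
  ultimately show ?thesis by (rule that)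
qed

text \<open>At a fine level most cells \<open>cell_map k c ` S\<close> meeting \<open>F\<close> are almost filled by \<open>F\<close>. In these the
  copy of \<open>cball y0 d0\<close> can be recentred at a point of \<open>F\<close> at the price of a slightly larger radius.
  Only open balls are removed, so that what remains of \<open>F\<close> is closed again.\<close>

lemma greedy_ball_step:
  assumes y0: "y0 \<in> sierpinski_gasket" and d0: "0 < d0" and \<epsilon>: "0 < \<epsilon>" "\<epsilon> \<le> 1"
    and F: "closed F" "0 < measure nu F" and \<delta>: "0 < \<delta>"
  obtains G F' where "finite G" "G \<subseteq> F \<times> {0<..\<delta>/2}" "closed F'" "F' \<subseteq> F"
    "F \<subseteq> F' \<union> (\<Union>(x, d)\<in>G. cball x d)"
    "cover_cost G \<le> (1 + \<epsilon>)\<^sup>2 / ball_density y0 d0 * (measure nu F - measure nu F')"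
    "measure nu F' \<le> (1 - measure nu (cball y0 d0) / 4) * measure nu F"
proof -
  define m where "m = measure nu (cball y0 d0)"
  have m: "0 < m" using nu_cball_pos[OF y0 d0] by (simp add: m_def)
  \<comment> \<open>Enlarging the radius by the factor t raises the cost by exactly 1 +
    \<epsilon>.\<close>
  define t where "t = (1 + \<epsilon>) powr (1 / gasket_dim)"
  have t: "1 < t" unfolding t_def using \<epsilon> gasket_dim_pos
    using powr_less_mono2[of "1 / gasket_dim" 1 "1 + \<epsilon>"] by simp
  have ts: "t powr gasket_dim = 1 + \<epsilon>" using \<epsilon> gasket_dim_pos by (simp add: t_def powr_powr)
  define r where "r = d0 * t"
  \<comment> \<open>The room gained: a ball of radius r still contains \<open>cball y0 d0\<close>
    when its centre is moved by at most \<eta>.\<close>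
  define \<eta> where "\<eta> = (r - d0) / 2"
  have \<eta>: "0 < \<eta>" "d0 + \<eta> < r" using t d0 by (simp_all add: \<eta>_def r_def field_simps)
  have r: "0 < r" using t d0 by (simp add: r_def)
  \<comment> \<open>The tolerated deficit of F in a good cell. The first bound forces F to meet the
    copy of \<open>cball y0 \<eta>\<close>, giving a centre; the second keeps the removed mass at
    least m / (1 + \<epsilon>).\<close>
  define \<tau> where "\<tau> = min (measure nu (cball y0 \<eta>) / 2) (m * \<epsilon> / (1 + \<epsilon>))"
  have \<tau>: "0 < \<tau>" "\<tau> < measure nu (cball y0 \<eta>)" "\<tau> \<le> m * \<epsilon> / (1 + \<epsilon>)"
    using nu_cball_pos[OF y0 \<eta>(1)] m \<epsilon> by (auto simp: \<tau>_def)
  have m\<tau>: "m / (1 + \<epsilon>) \<le> m - \<tau>"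
  proof -
    have "m / (1 + \<epsilon>) = m - m * \<epsilon> / (1 + \<epsilon>)" using \<epsilon> by (simp add: field_simps)
    then show ?thesis using \<tau>(3) by linarith
  qed
  \<comment> \<open>Each bad cell wastes at least \<tau> and all cells together waste at most
    \<kappa> * 3^k, so bad cells account for at most half the mass of F.\<close>
  define \<kappa> where "\<kappa> = \<tau> * measure nu F / 2"
  have \<kappa>: "0 < \<kappa>" using \<tau> F by (simp add: \<kappa>_def)
  obtain k where k: "card (hits k F) / 3^k \<le> measure nu F + \<kappa>" "r / 2^k \<le> \<delta> / 2"
    using fine_level[OF F(1) \<kappa>, of "\<delta> / 2" r] \<delta> by auto
  define q where "q c = measure nu (cell_map k c -` F)" for c
  have q1: "q c \<le> 1" for c by (simp add: q_def)
  have Fb: "F \<in> sets borel" using F(1) by (rule borel_closed)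
  define good where "good = {c \<in> hits k F. 1 - q c \<le> \<tau>}"
  define bad where "bad = hits k F - good"
  have fin: "finite good" "finite bad" by (auto simp: good_def bad_def)
  have "\<tau> \<le> 1 - q c" if "c \<in> bad" for c using that unfolding good_def bad_def by auto
  then have "card bad * \<tau> \<le> (\<Sum>c\<in>bad. 1 - q c)" by (rule sum_bounded_below)
  also have "\<dots> \<le> (\<Sum>c\<in>hits k F. 1 - q c)"
    using q1 by (intro sum_mono2) (auto simp: bad_def)
  also have "\<dots> = card (hits k F) - (\<Sum>c\<in>hits k F. q c)" by (simp add: sum_subtractf)
  also have "(\<Sum>c\<in>hits k F. q c) = measure nu F * 3^k"
    using nu_hits[OF Fb, of k] by (simp add: q_def)
  also have "card (hits k F) - measure nu F * 3^k \<le> \<kappa> * 3^k" using k(1) by (simp add: field_simps)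
  finally have bad: "card bad \<le> measure nu F / 2 * 3^k" using \<tau>(1) by (simp add: \<kappa>_def)
  have "card (hits k F) = card good + card bad"
    using card_Un_disjoint[OF fin] by (simp add: bad_def good_def Int_Diff Un_absorb1 Collect_conj_eq)
  moreover have "measure nu F * 3^k \<le> card (hits k F)"
    using nu_le_hits[OF Fb, of k] by (simp add: field_simps)
  ultimately have good: "measure nu F / 2 * 3^k \<le> card good" using bad by simp
  have "\<exists>y. cell_map k c y \<in> F \<and> dist y y0 \<le> \<eta>" if "c \<in> good" for c
  proof (rule ccontr)
    assume "\<not> ?thesis"
    then have "cell_map k c -` F \<inter> cball y0 \<eta> = {}" by (auto simp: dist_commute)
    then have "q c + measure nu (cball y0 \<eta>) = measure nu (cell_map k c -` F \<union> cball y0 \<eta>)"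
      unfolding q_def using Fb by (intro nu.finite_measure_Union[symmetric]) (auto intro: vimage_borel)
    also have "\<dots> \<le> 1" by simp
    finally show False using that \<tau>(2) by (simp add: good_def)
  qed
  then obtain y where y: "\<And>c. c \<in> good \<Longrightarrow> cell_map k c (y c) \<in> F"
    "\<And>c. c \<in> good \<Longrightarrow> dist (y c) y0 \<le> \<eta>" by metis
  define G where "G = (\<lambda>c. (cell_map k c (y c), r / 2^k)) ` good"
  define F' where "F' = F - (\<Union>c\<in>good. ball (cell_map k c (y c)) (r / 2^k))"
  define q' where "q' c = measure nu (cell_map k c -` F')" for c
  have F'b: "F' \<in> sets borel" "closed F'"
    using F(1) by (auto simp: F'_def intro!: borel_closed closed_Diff)
  have q'q: "q' c \<le> q c" for c
    unfolding q_def q'_def using Fb by (intro nu.finite_measure_mono) (auto simp: F'_def intro: vimage_borel)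
  \<comment> \<open>In cell coordinates the removed open ball contains all of
    \<open>cball y0 d0\<close>, so the remainder misses a set of mass m.\<close>
  have q': "q' c \<le> 1 - m" if c: "c \<in> good" for c
  proof -
    have "z \<notin> cell_map k c -` F'" if "z \<in> cball y0 d0" for z
    proof -
      have "dist (y c) z < r" using dist_triangle[of "y c" z y0] y(2)[OF c] that \<eta>(2) by simp
      then have "cell_map k c z \<in> ball (cell_map k c (y c)) (r / 2^k)"
        by (simp add: dist_cell_map divide_strict_right_mono)
      then show ?thesis using c by (auto simp: F'_def)
    qed
    then have "cell_map k c -` F' \<inter> cball y0 d0 = {}" by blast
    then have "q' c + m = measure nu (cell_map k c -` F' \<union> cball y0 d0)"
      unfolding q'_def m_def using F'b
      by (intro nu.finite_measure_Union[symmetric]) (auto intro: vimage_borel)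
    also have "\<dots> \<le> 1" by simp
    finally show ?thesis by simp
  qed
  \<comment> \<open>In a good cell the mass falls from at least 1 - \<tau> to at most 1 - m.\<close>
  have "card good * (m / (1 + \<epsilon>)) \<le> (\<Sum>c\<in>good. q c - q' c)"
  proof -
    have "m / (1 + \<epsilon>) \<le> q c - q' c" if "c \<in> good" for c
      using q'[OF that] that m\<tau> unfolding good_def by simp
    then show ?thesis using sum_bounded_below[of good "m / (1 + \<epsilon>)" "\<lambda>c. q c - q' c"] by simp
  qed
  also have "\<dots> \<le> (\<Sum>c\<in>cells k. q c - q' c)"
    using q'q by (intro sum_mono2) (auto simp: good_def hits_def)
  also have "\<dots> = (measure nu F - measure nu F') * 3^k"
    using nu_cells[OF Fb, of k] nu_cells[OF F'b(1), of k]
    by (simp add: q_def q'_def sum_subtractf left_diff_distrib)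
  finally have removed: "card good * (m / (1 + \<epsilon>)) \<le> (measure nu F - measure nu F') * 3^k" .
  show ?thesis
  proof (rule that)
    show "finite G" using fin by (simp add: G_def)
    show "G \<subseteq> F \<times> {0<..\<delta>/2}" using y(1) r k(2) by (auto simp: G_def)
    show "closed F'" by (rule F'b)
    show "F' \<subseteq> F" by (auto simp: F'_def)
    show "F \<subseteq> F' \<union> (\<Union>(x, d)\<in>G. cball x d)" by (auto simp: F'_def G_def)
    have dens: "(2 * d0) powr gasket_dim = m / ball_density y0 d0"
      using m d0 by (simp add: ball_density_def m_def)
    have dpos: "0 < ball_density y0 d0" using m d0 by (simp add: ball_density_def m_def)
    have "cover_cost G \<le> card good * (2 * (r / 2^k)) powr gasket_dim"
      unfolding G_def by (rule cover_cost_image[OF fin(1)])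
    also have "(2 * (r / 2^k)) powr gasket_dim = (2 * d0 * t) powr gasket_dim / 3^k"
      using r powr_gasket_dim_scale[of "2 * d0 * t" k] by (simp add: r_def mult.assoc)
    also have "(2 * d0 * t) powr gasket_dim = (1 + \<epsilon>) * (m / ball_density y0 d0)"
      using d0 t by (subst powr_mult) (simp_all add: ts dens)
    \<comment> \<open>One factor 1 + \<epsilon> pays for the larger radius, the other for the
      deficit in the removed mass.\<close>
    also have "card good * ((1 + \<epsilon>) * (m / ball_density y0 d0) / 3^k) =
        (1 + \<epsilon>)\<^sup>2 / ball_density y0 d0 * (card good * (m / (1 + \<epsilon>)) / 3^k)"
      using \<epsilon> by (simp add: power2_eq_square)
    also have "\<dots> \<le> (1 + \<epsilon>)\<^sup>2 / ball_density y0 d0 * (measure nu F - measure nu F')"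
      using dpos by (intro mult_left_mono pos_divide_le_eq[THEN iffD2, OF _ removed]) simp_all
    finally show "cover_cost G \<le> (1 + \<epsilon>)\<^sup>2 / ball_density y0 d0 * (measure nu F - measure nu F')" .
    \<comment> \<open>The 4 is 2 * 2: good cells number at least half of
      \<open>measure nu F * 3^k\<close>, and 1 / (1 + \<epsilon>) is at least 1/2.\<close>
    have "measure nu F * (m / 4) * 3^k = measure nu F / 2 * 3^k * (m / 2)" by simp
    also have "\<dots> \<le> card good * (m / (1 + \<epsilon>))"
      using good m \<epsilon> by (intro mult_mono divide_left_mono) auto
    also note removed
    finally have "measure nu F * (m / 4) \<le> measure nu F - measure nu F'"
      by (rule mult_right_le_imp_le) simp
    then show "measure nu F' \<le> (1 - measure nu (cball y0 d0) / 4) * measure nu F"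
      by (simp add: m_def algebra_simps)
  qed
qed

text \<open>Each round is charged to the mass it removes, so these charges telescope to at most the
  first term times the mass of F. The crude cover is applied once, to a remainder of proportion at
  most \<rho>^n, so \<gamma> is also paid only once. Centres in the remainder are centres in
  F.\<close>

lemma iterated_ball_cover:
  assumes y0: "y0 \<in> sierpinski_gasket" and d0: "0 < d0" and \<epsilon>: "0 < \<epsilon>" "\<epsilon> \<le> 1"
    and \<delta>: "0 < \<delta>" and \<gamma>: "0 < \<gamma>"
  shows "closed F \<Longrightarrow> F \<subseteq> sierpinski_gasket \<Longrightarrow> \<exists>G. ball_cover \<delta> F G \<and> cover_cost G \<le>
    ((1 + \<epsilon>)\<^sup>2 / ball_density y0 d0 + 9 * (1 - measure nu (cball y0 d0) / 4)^n) * measure nu F + \<gamma>"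
proof (induction n arbitrary: F)
  case 0
  obtain G where G: "ball_cover \<delta> F G" "cover_cost G \<le> 9 * measure nu F + \<gamma>"
    using crude_ball_cover[OF 0 \<delta> \<gamma>] .
  have "0 \<le> ball_density y0 d0" by (simp add: ball_density_def)
  then have "9 * measure nu F \<le> ((1 + \<epsilon>)\<^sup>2 / ball_density y0 d0 + 9) * measure nu F"
    by (intro mult_right_mono) auto
  then show ?case using G by (intro exI[of _ G]) simp
next
  case (Suc n)
  let ?\<rho> = "1 - measure nu (cball y0 d0) / 4" and ?a = "(1 + \<epsilon>)\<^sup>2 / ball_density y0 d0"
  have \<rho>: "0 \<le> ?\<rho>" using nu.prob_le_1[of "cball y0 d0"] by linarith
  show ?case
  proof (cases "measure nu F = 0")
    \<comment> \<open>With no mass left to remove, a round is impossible, but the crude cover costs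
      at most \<gamma>.\<close>
    case True
    then show ?thesis using crude_ball_cover[OF Suc.prems \<delta> \<gamma>] by auto
  next
    case False
    then have "0 < measure nu F" by (simp add: zero_less_measure_iff)
    from greedy_ball_step[OF y0 d0 \<epsilon> Suc.prems(1) this \<delta>]
    obtain G F' where G: "finite G" "G \<subseteq> F \<times> {0<..\<delta>/2}" "closed F'" "F' \<subseteq> F"
      "F \<subseteq> F' \<union> (\<Union>(x, d)\<in>G. cball x d)"
      "cover_cost G \<le> ?a * (measure nu F - measure nu F')"
      "measure nu F' \<le> ?\<rho> * measure nu F" .
    obtain G' where G': "ball_cover \<delta> F' G'" "cover_cost G' \<le> (?a + 9 * ?\<rho>^n) * measure nu F' + \<gamma>"
      using Suc.IH[OF G(3)] G(4) Suc.prems(2) by blast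
    have G'': "finite G'" "G' \<subseteq> F' \<times> {0<..\<delta>/2}" "F' \<subseteq> (\<Union>(x, d)\<in>G'. cball x d)"
      using G'(1) by (simp_all add: ball_cover_def)
    have "ball_cover \<delta> F (G \<union> G')"
      unfolding ball_cover_def
    proof (intro conjI)
      show "finite (G \<union> G')" using G(1) G''(1) by simp
      show "G \<union> G' \<subseteq> F \<times> {0<..\<delta>/2}"
        by (intro Un_least G(2) order_trans[OF G''(2)] Sigma_mono G(4)) simp
      show "F \<subseteq> (\<Union>(x, d)\<in>G \<union> G'. cball x d)"
        unfolding UN_Un using G(5) G''(3) by blast
    qed
    moreover have "cover_cost (G \<union> G') \<le> cover_cost G + cover_cost G'"
      using G(1) G'(1) by (intro cover_cost_Un) (auto simp: ball_cover_def)
    moreover have "9 * ?\<rho>^n * measure nu F' \<le> 9 * ?\<rho>^n * (?\<rho> * measure nu F)"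
      using \<rho> by (intro mult_left_mono G(7)) auto
    moreover have "?a * (measure nu F - measure nu F') + ((?a + 9 * ?\<rho>^n) * measure nu F' + \<gamma>) =
        ?a * measure nu F + 9 * ?\<rho>^n * measure nu F' + \<gamma>"
      by (simp only: distrib_right right_diff_distrib)
    moreover have "(?a + 9 * ?\<rho>^Suc n) * measure nu F + \<gamma> =
        ?a * measure nu F + 9 * ?\<rho>^n * (?\<rho> * measure nu F) + \<gamma>"
      by (simp only: distrib_right power_Suc mult.assoc mult.left_commute[of ?\<rho>])
    ultimately have "cover_cost (G \<union> G') \<le> (?a + 9 * ?\<rho>^Suc n) * measure nu F + \<gamma>"
      using G(6) G'(2) by linarith
    with \<open>ball_cover \<delta> F (G \<union> G')\<close> show ?thesis by blast
  qed
qed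

lemma near_optimal_ball_cover:
  assumes y0: "y0 \<in> sierpinski_gasket" and d0: "0 < d0"
    and F: "closed F" "F \<subseteq> sierpinski_gasket" and \<delta>: "0 < \<delta>" and \<gamma>: "0 < \<gamma>"
  obtains G where "ball_cover \<delta> F G" "cover_cost G \<le> 1 / ball_density y0 d0 + \<gamma>"
proof -
  define T where "T = 1 / ball_density y0 d0"
  have m: "0 < measure nu (cball y0 d0)" by (rule nu_cball_pos[OF y0 d0])
  then have T: "0 < T" using d0 by (simp add: T_def ball_density_def)
  \<comment> \<open>The error \<gamma> is split into thirds. Since \<epsilon> <= 1, (1 +
    \<epsilon>)^2 is at most 1 + 3 * \<epsilon>, and 3 * \<epsilon> * T is at most \<gamma> /
    3.\<close>
  define \<epsilon> where "\<epsilon> = min 1 (\<gamma> / (9 * T))"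
  have \<epsilon>: "0 < \<epsilon>" "\<epsilon> \<le> 1" "\<epsilon> \<le> \<gamma> / (9 * T)" using \<gamma> T by (simp_all add: \<epsilon>_def)
  let ?\<rho> = "1 - measure nu (cball y0 d0) / 4"
  have \<rho>: "0 \<le> ?\<rho>" "?\<rho> < 1" using m nu.prob_le_1[of "cball y0 d0"] by linarith+
  have "(\<lambda>n. ?\<rho>^n) \<longlonglongrightarrow> 0" by (rule LIMSEQ_realpow_zero[OF \<rho>])
  \<comment> \<open>The 27 is 9 * 3: the remainder, paid at rate 9, costs at most another
    third.\<close>
  from order_tendstoD(2)[OF this, of "\<gamma> / 27"] \<gamma> obtain n where n: "?\<rho>^n < \<gamma> / 27"
    by (auto simp: eventually_sequentially)
  have "0 < \<gamma> / 3" using \<gamma> by simp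
  from iterated_ball_cover[OF y0 d0 \<epsilon>(1,2) \<delta> this F, of n]
  obtain G where G: "ball_cover \<delta> F G"
    "cover_cost G \<le> ((1 + \<epsilon>)\<^sup>2 * T + 9 * ?\<rho>^n) * measure nu F + \<gamma> / 3"
    by (auto simp: T_def)
  have "(1 + \<epsilon>)\<^sup>2 \<le> 1 + 3 * \<epsilon>" using mult_right_mono[of \<epsilon> 1 \<epsilon>] \<epsilon>
    by (simp add: power2_eq_square algebra_simps)
  then have "(1 + \<epsilon>)\<^sup>2 * T \<le> (1 + 3 * \<epsilon>) * T" using T by (intro mult_right_mono) auto
  also have "\<dots> \<le> T + \<gamma> / 3" using \<epsilon>(3) T by (simp add: field_simps)
  finally have 1: "(1 + \<epsilon>)\<^sup>2 * T + 9 * ?\<rho>^n \<le> T + \<gamma> / 3 + \<gamma> / 3" using n by simp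
  have "((1 + \<epsilon>)\<^sup>2 * T + 9 * ?\<rho>^n) * measure nu F \<le> ((1 + \<epsilon>)\<^sup>2 * T + 9 * ?\<rho>^n) * 1"
    using T \<rho> by (intro mult_left_mono) auto
  then have "cover_cost G \<le> T + \<gamma>" using G(2) 1 by simp
  with G(1) show ?thesis using that by (simp add: T_def)
qed

section \<open>From finite families of balls to the centred measure\<close>

lemma centred_premeasure_le_ball_cover:
  assumes G: "ball_cover \<delta> F G" and F: "F \<noteq> {}" and \<delta>: "0 < \<delta>" and \<gamma>: "0 < \<gamma>"
  shows "centred_premeasure gasket_dim \<delta> F \<le> ennreal (cover_cost G + \<gamma>)"
proof -
  obtain x0 where x0: "x0 \<in> F" using F by blast
  have fin: "finite G" and sub: "G \<subseteq> F \<times> {0<..\<delta>/2}" and cov: "F \<subseteq> (\<Union>(x, d)\<in>G. cball x d)"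
    using G by (simp_all add: ball_cover_def)
  define n where "n = card G"
  obtain h where h: "bij_betw h {..<n} G"
    using ex_bij_betw_nat_finite[OF fin] by (auto simp: atLeast0LessThan n_def)
  \<comment> \<open>Admissible covers are infinite sequences of balls of positive radius, so the
    finite family is continued by balls about one point of F with costs at most \<gamma> / 2^(i+1),
    in total at most \<gamma>.\<close>
  define pad where "pad i = min (\<delta>/2) ((\<gamma> * (1/2)^Suc i) powr (1 / gasket_dim) / 2)" for i
  have pad: "0 < pad i" "2 * pad i \<le> \<delta>" "(2 * pad i) powr gasket_dim \<le> \<gamma> * (1/2)^Suc i" for i
  proof -
    show p: "0 < pad i" "2 * pad i \<le> \<delta>" using \<delta> \<gamma> by (auto simp: pad_def)
    have "2 * pad i \<le> (\<gamma> * (1/2)^Suc i) powr (1 / gasket_dim)" by (simp add: pad_def min_def)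
    then have "(2 * pad i) powr gasket_dim \<le> ((\<gamma> * (1/2)^Suc i) powr (1 / gasket_dim)) powr gasket_dim"
      using p gasket_dim_pos by (intro powr_mono2) auto
    then show "(2 * pad i) powr gasket_dim \<le> \<gamma> * (1/2)^Suc i"
      using \<gamma> gasket_dim_pos by (simp add: powr_powr)
  qed
  define x where "x i = (if i < n then fst (h i) else x0)" for i
  define d where "d i = (if i < n then snd (h i) else pad i)" for i
  have hG: "h i \<in> G" if "i < n" for i using h that by (auto simp: bij_betw_def)
  have "x i \<in> F \<and> 0 < d i \<and> 2 * d i \<le> \<delta>" for i
  proof (cases "i < n")
    case True
    then show ?thesis using subsetD[OF sub hG[OF True]] by (auto simp: x_def d_def mem_Times_iff)
  next
    case False
    then show ?thesis using pad[of i] x0 by (simp add: x_def d_def)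
  qed
  moreover have "F \<subseteq> (\<Union>i. cball (x i) (d i))"
  proof
    fix z assume "z \<in> F"
    then obtain p where p: "p \<in> G" "z \<in> cball (fst p) (snd p)" using cov by (auto simp: case_prod_unfold)
    then obtain i where i: "i < n" "h i = p" using bij_betw_imp_surj_on[OF h] by auto
    then have "z \<in> cball (x i) (d i)" using p(2) by (simp add: x_def d_def)
    then show "z \<in> (\<Union>i. cball (x i) (d i))" by blast
  qed
  ultimately have "centred_premeasure gasket_dim \<delta> F \<le> (\<Sum>i. ennreal ((2 * d i) powr gasket_dim))"
    unfolding centred_premeasure_def by (intro INF_lower2[of "(x, d)"]) auto
  also have "\<dots> \<le> (\<Sum>i. ennreal (if i < n then (2 * snd (h i)) powr gasket_dim else 0)
      + ennreal (\<gamma> * (1/2)^Suc i))"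
  proof (intro suminf_le)
    show "ennreal ((2 * d i) powr gasket_dim) \<le>
        ennreal (if i < n then (2 * snd (h i)) powr gasket_dim else 0) + ennreal (\<gamma> * (1/2)^Suc i)" for i
      using pad(3)[of i] by (auto simp: d_def intro!: ennreal_leI)
  qed auto
  also have "\<dots> = (\<Sum>i. ennreal (if i < n then (2 * snd (h i)) powr gasket_dim else 0))
      + (\<Sum>i. ennreal (\<gamma> * (1/2)^Suc i))"
    by (rule suminf_add[symmetric]) auto
  also have "(\<Sum>i. ennreal (\<gamma> * (1/2)^Suc i)) = ennreal \<gamma>"
    using \<gamma> power_half_series[THEN sums_mult, of \<gamma>] by (intro suminf_ennreal_eq) auto
  also have "(\<Sum>i. ennreal (if i < n then (2 * snd (h i)) powr gasket_dim else 0)) =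
      (\<Sum>i<n. ennreal (if i < n then (2 * snd (h i)) powr gasket_dim else 0))"
    by (rule suminf_finite) auto
  also have "\<dots> = (\<Sum>i<n. ennreal ((2 * snd (h i)) powr gasket_dim))"
    by (rule sum.cong) auto
  also have "\<dots> = (\<Sum>p\<in>G. ennreal ((2 * snd p) powr gasket_dim))"
    by (rule sum.reindex_bij_betw[OF h])
  also have "\<dots> = ennreal (cover_cost G)"
    by (simp add: cover_cost_def case_prod_unfold)
  also have "ennreal (cover_cost G) + ennreal \<gamma> = ennreal (cover_cost G + \<gamma>)"
    using \<gamma> by (subst ennreal_plus) (auto simp: cover_cost_def intro!: sum_nonneg)
  finally show ?thesis .
qed

lemma centred_measure0_eq_SUP:
  "A \<noteq> {} \<Longrightarrow> centred_measure0 s A = (SUP \<delta>\<in>{0<..}. centred_premeasure s \<delta> A)"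
  unfolding centred_measure0_def
  by (simp, rule Lim_at_right_0_eq_SUP)
     (fastforce simp: centred_premeasure_def intro!: INF_superset_mono intro: order_trans)

text \<open>Since the ball is arbitrary, this serves twice: at the ball of maximal density it bounds
  the measure from above, and at every other admissible ball it gives minimality.\<close>

lemma centred_measure_gasket_le:
  assumes y0: "y0 \<in> sierpinski_gasket" and d0: "0 < d0"
  shows "centred_measure gasket_dim sierpinski_gasket \<le> ennreal (1 / ball_density y0 d0)"
  unfolding centred_measure_def
proof (rule SUP_least)
  fix F assume "F \<in> {F. F \<subseteq> sierpinski_gasket \<and> closed F}"
  then have F: "closed F" "F \<subseteq> sierpinski_gasket" by auto
  show "centred_measure0 gasket_dim F \<le> ennreal (1 / ball_density y0 d0)"
  proof (cases "F = {}")
    case True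
    then show ?thesis by (simp add: centred_measure0_def)
  next
    case False
    show ?thesis unfolding centred_measure0_eq_SUP[OF False]
    proof (rule SUP_least)
      fix \<delta> :: real assume "\<delta> \<in> {0<..}"
      then have \<delta>: "0 < \<delta>" by simp
      show "centred_premeasure gasket_dim \<delta> F \<le> ennreal (1 / ball_density y0 d0)"
      proof (rule ennreal_le_epsilon)
        fix e :: real assume "0 < e"
        then have e: "0 < e / 2" by simp
        obtain G where G: "ball_cover \<delta> F G" "cover_cost G \<le> 1 / ball_density y0 d0 + e / 2"
          using near_optimal_ball_cover[OF y0 d0 F \<delta> e] .
        have "0 \<le> ball_density y0 d0" by (simp add: ball_density_def)
        have "centred_premeasure gasket_dim \<delta> F \<le> ennreal (cover_cost G + e / 2)"
          by (rule centred_premeasure_le_ball_cover[OF G(1) False \<delta> e])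
        also have "\<dots> \<le> ennreal (1 / ball_density y0 d0 + e)" using G(2) by (intro ennreal_leI) simp
        also have "\<dots> = ennreal (1 / ball_density y0 d0) + ennreal e"
          using \<open>0 \<le> ball_density y0 d0\<close> e by (subst ennreal_plus) auto
        finally show "centred_premeasure gasket_dim \<delta> F \<le> ennreal (1 / ball_density y0 d0) + ennreal e" .
      qed
    qed
  qed
qed

lemma centred_measure_gasket_ge:
  assumes \<theta>: "0 < \<theta>"
    and le: "\<And>x d. x \<in> sierpinski_gasket \<Longrightarrow> 0 < d \<Longrightarrow> d < sqrt 3 / 4 \<Longrightarrow> ball_density x d \<le> \<theta>"
  shows "ennreal (1 / \<theta>) \<le> centred_measure gasket_dim sierpinski_gasket"
proof -
  let ?S = sierpinski_gasket
  \<comment> \<open>At scale 1/4 all radii are at most 1/8, below sqrt 3 / 4. The gasket itself is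
    one of the closed sets in the supremum, so its own premeasure is enough.\<close>
  have "ennreal (1 / \<theta>) \<le> centred_premeasure gasket_dim (1/4) ?S"
    unfolding centred_premeasure_def
  proof (rule INF_greatest, clarify)
    fix x :: "nat \<Rightarrow> real^2" and d :: "nat \<Rightarrow> real"
    assume xd: "\<forall>i. x i \<in> ?S \<and> 0 < d i \<and> 2 * d i \<le> 1/4" and cov: "?S \<subseteq> (\<Union>i. cball (x i) (d i))"
    have "measure nu (cball (x i) (d i)) \<le> \<theta> * (2 * d i) powr gasket_dim" for i
    proof -
      have "1 < sqrt (3::real)" by simp
      moreover have "d i \<le> 1/8" "0 < d i" "x i \<in> ?S" using xd[THEN spec, of i] by auto
      ultimately have "ball_density (x i) (d i) \<le> \<theta>" by (intro le) linarith+
      then show ?thesis using \<open>0 < d i\<close> by (simp add: ball_density_def divide_le_eq)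
    qed
    note b = this
    have "1 = emeasure nu ?S" by (simp add: nu.emeasure_eq_measure nu_gasket)
    also have "\<dots> \<le> emeasure nu (\<Union>i. cball (x i) (d i))" by (intro emeasure_mono cov) auto
    also have "\<dots> \<le> (\<Sum>i. emeasure nu (cball (x i) (d i)))"
      by (intro emeasure_subadditive_countably) auto
    also have "\<dots> \<le> (\<Sum>i. ennreal \<theta> * ennreal ((2 * d i) powr gasket_dim))"
      using b \<theta> by (intro suminf_le) (auto simp: nu.emeasure_eq_measure simp flip: ennreal_mult)
    also have "\<dots> = ennreal \<theta> * (\<Sum>i. ennreal ((2 * d i) powr gasket_dim))" by simp
    finally have "1 / ennreal \<theta> \<le> (\<Sum>i. ennreal ((2 * d i) powr gasket_dim))"
      using \<theta> by (intro divide_le_posI_ennreal) auto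
    moreover have "ennreal (1 / \<theta>) = 1 / ennreal \<theta>" using divide_ennreal[of 1 \<theta>] \<theta> by simp
    ultimately show "ennreal (1 / \<theta>) \<le> (\<Sum>i. ennreal ((2 * d i) powr gasket_dim))" by simp
  qed
  also have "\<dots> \<le> centred_measure0 gasket_dim ?S"
    unfolding centred_measure0_eq_SUP[OF gasket_nonempty] by (rule SUP_upper) simp
  also have "\<dots> \<le> centred_measure gasket_dim ?S"
    unfolding centred_measure_def by (rule SUP_upper) simp
  finally show ?thesis .
qed

lemma inverse_gasket_density:
  assumes "x \<in> sierpinski_gasket" "0 < d"
  shows "inverse (gasket_density x d) = ennreal (1 / ball_density x d)"
proof -
  have "gasket_density x d = ennreal (ball_density x d)"
    using assms by (simp add: gasket_density_def ball_density_def gasket_mu_eq_nu divide_ennreal)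
  moreover have "0 < ball_density x d"
    using assms nu_cball_pos[OF assms] by (simp add: ball_density_def)
  ultimately show ?thesis by (simp add: inverse_ennreal inverse_eq_divide)
qed

theorem theorem7:
  shows "is_minimum (centred_measure gasket_dim sierpinski_gasket)
           {inverse (gasket_density x d) | x d.
              x \<in> gasket_map 0 ` gasket_map 1 ` sierpinski_gasket \<and>
              sqrt 3 / 16 \<le> d \<and> d \<le> sqrt 3 / 8}"
proof -
  let ?S = sierpinski_gasket and ?K = "cell_map 2 (1, 0) ` sierpinski_gasket"
  have "compact ?K" "?K \<noteq> {}"
    by (auto intro: compact_continuous_image continuous_cell_map compact_gasket)
  then obtain x d where xd: "x \<in> ?K" "sqrt 3 / 16 \<le> d" "d \<le> sqrt 3 / 8"
    and max: "\<And>y e. y \<in> ?K \<Longrightarrow> sqrt 3 / 16 \<le> e \<Longrightarrow> e \<le> sqrt 3 / 8 \<Longrightarrow>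
      ball_density y e \<le> ball_density x d"
    using density_attains_max[of ?K "sqrt 3 / 16" "sqrt 3 / 8"] by auto
  have s3: "0 < sqrt (3::real)" by simp
  have d: "0 < d" using xd(2) s3 by linarith
  have x: "x \<in> ?S" using xd(1) cell01_in_gasket by blast
  have pos: "0 < ball_density x d"
    using d nu_cball_pos[OF x d] by (simp add: ball_density_def)
  have "ball_density y e \<le> ball_density x d" if ye: "y \<in> ?S" "0 < e" "e < sqrt 3 / 4" for y e
  proof -
    obtain y' e' where y': "y' \<in> ?K" "sqrt 3 / 16 \<le> e'" "e' \<le> sqrt 3 / 8"
      and le: "ball_density y e \<le> ball_density y' e'"
      using density_le_density_cell01[OF ye] .
    from le max[OF y'] show ?thesis by (rule order_trans)
  qed
  then have "ennreal (1 / ball_density x d) \<le> centred_measure gasket_dim ?S"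
    by (rule centred_measure_gasket_ge[OF pos])
  then have eq: "centred_measure gasket_dim ?S = inverse (gasket_density x d)"
    using centred_measure_gasket_le[OF x d] by (simp add: inverse_gasket_density[OF x d])
  show ?thesis
    unfolding is_minimum_def gasket_cell01
  proof (intro conjI ballI)
    show "centred_measure gasket_dim ?S \<in> {inverse (gasket_density x d) | x d.
        x \<in> ?K \<and> sqrt 3 / 16 \<le> d \<and> d \<le> sqrt 3 / 8}"
      using eq xd by blast
    fix v assume "v \<in> {inverse (gasket_density x d) | x d.
        x \<in> ?K \<and> sqrt 3 / 16 \<le> d \<and> d \<le> sqrt 3 / 8}"
    then obtain y e where ye: "v = inverse (gasket_density y e)" "y \<in> ?K" "sqrt 3 / 16 \<le> e" by blast
    have "0 < e" using ye(3) s3 by linarith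
    have "y \<in> ?S" using ye(2) cell01_in_gasket by blast
    from centred_measure_gasket_le[OF this \<open>0 < e\<close>]
    show "centred_measure gasket_dim ?S \<le> v"
      unfolding ye(1) inverse_gasket_density[OF \<open>y \<in> ?S\<close> \<open>0 < e\<close>] .
  qed
qed

end
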